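(* Let $\mathcal{B}$ be a building set on $[n]$. Consider $\mathbb{R}^n$ with standard basis $e_1,\dots,e_n$ and start with the cross polytope $Q_0=\mathrm{Conv}(\pm e_1,\dots,\pm e_n)$, labelling the vertex $e_i$ by $\{i\}\in\mathcal{B}$ and the vertex $-e_i$ by $x_i$, for all $i\in[n]$. List the non-singleton elements of $\mathcal{B}$ in order of decreasing cardinality, and for each such element $I$ in turn, perform a stellar subdivision of the current simplicial polytope on the face whose vertices are those labelled $\{i\}$ for $i\in I$, labelling the new vertex by $I$. Then each of these stellar subdivisions is well defined (the required vertex set spans a face at that stage), and the boundary complex of the resulting simplicial polytope $P_{\mathcal{B}}$ is isomorphic, via the labelling of vertices, to the extended nested complex $\mathcal{N}^{\square}(\mathcal{B})$. In particular $\mathcal{N}^{\square}(\mathcal{B})$ is the boundary complex of a simplicial polytope.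
   Context: A building set on a finite set $X$ is a collection $\mathcal{B}$ of nonempty subsets of $X$ such that (B1) $\{i\}\in\mathcal{B}$ for all $i\in X$, and (B2) if $I,J\in\mathcal{B}$ and $I\cap J\neq\varnothing$ then $I\cup J\in\mathcal{B}$. An extended nested collection of $\mathcal{B}$ is a set $\{I_1,\dots,I_m,x_{i_1},\dots,x_{i_r}\}$ where $I_1,\dots,I_m\in\mathcal{B}$ (maximal elements allowed) and $x_{i_1},\dots,x_{i_r}$ are formal symbols with $i_1,\dots,i_r\in X$, such that: (1) any two $I_j,I_k$ are nested or disjoint; (2) for any $k\ge 2$ pairwise disjoint members among the $I_j$, their union is not in $\mathcal{B}$; (3) no $i_\ell$ belongs to any $I_j$. The extended nested complex $\mathcal{N}^{\square}(\mathcal{B})$ is the simplicial complex with vertex set $\mathcal{B}\cup\{x_i: i\in X\}$ whose faces are the extended nested collections. For a simplicial polytope $Q$ and a face $F$ of $Q$, the stellar subdivision of $Q$ on $F$ is the polytope $\mathrm{Conv}(Q\cup\{v\})$ where $v$ is a point lying beyond exactly the facet hyperplanes of those facets of $Q$ containing $F$ and beneath all other facet hyperplanes; it is simplicial, and combinatorially its boundary complex is obtained from that of $Q$ by removing all faces containing $F$ and adding all faces of the form $\{v\}\cup G\cup H$ with $G$ a proper subset of $F$ and $H$ a face of the link of $F$. *)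

theory Defs
  imports "HOL-Analysis.Analysis"
begin

definition building_set :: "'a set \<Rightarrow> 'a set set \<Rightarrow> bool" where
  "building_set X B \<longleftrightarrow>
     finite X \<and> B \<subseteq> Pow X \<and> {} \<notin> B \<and>
     (\<forall>i\<in>X. {i} \<in> B) \<and>
     (\<forall>I\<in>B. \<forall>J\<in>B. I \<inter> J \<noteq> {} \<longrightarrow> I \<union> J \<in> B)"

text \<open>The vertices of the extended nested complex: \<open>Block I\<close> stands for an element \<open>I\<close> of the
  building set, and \<open>Formal i\<close> for the formal symbol \<open>x\<^sub>i\<close>.\<close>

datatype 'a label = Block "'a set" | Formal 'a

definition extended_nested_collection :: "'a set \<Rightarrow> 'a set set \<Rightarrow> 'a label set \<Rightarrow> bool" where
  "extended_nested_collection X B \<sigma> \<longleftrightarrow>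
     \<sigma> \<subseteq> Block ` B \<union> Formal ` X \<and>
     (\<forall>I J. Block I \<in> \<sigma> \<longrightarrow> Block J \<in> \<sigma> \<longrightarrow> I \<subseteq> J \<or> J \<subseteq> I \<or> I \<inter> J = {}) \<and>
     (\<forall>C. Block ` C \<subseteq> \<sigma> \<longrightarrow> card C \<ge> 2 \<longrightarrow> pairwise disjnt C \<longrightarrow> \<Union>C \<notin> B) \<and>
     (\<forall>i I. Formal i \<in> \<sigma> \<longrightarrow> Block I \<in> \<sigma> \<longrightarrow> i \<notin> I)"

text \<open>An abstract simplicial complex is given as its vertex set together with its set of faces,
  the empty face included.\<close>

type_synonym 'v abstract_complex = "'v set \<times> 'v set set"

definition complex_iso ::
    "('v \<Rightarrow> 'w) \<Rightarrow> 'v abstract_complex \<Rightarrow> 'w abstract_complex \<Rightarrow> bool" where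
  "complex_iso f K L \<longleftrightarrow>
     bij_betw f (fst K) (fst L) \<and>
     (\<forall>\<sigma>. \<sigma> \<subseteq> fst K \<longrightarrow> (\<sigma> \<in> snd K \<longleftrightarrow> f ` \<sigma> \<in> snd L))"

definition extended_nested_complex :: "'a set \<Rightarrow> 'a set set \<Rightarrow> 'a label abstract_complex" where
  "extended_nested_complex X B =
     (Block ` B \<union> Formal ` X, {\<sigma>. extended_nested_collection X B \<sigma>})"

definition simplicial_polytope :: "'a::euclidean_space set \<Rightarrow> bool" where
  "simplicial_polytope Q \<longleftrightarrow>
     polytope Q \<and> (\<forall>F. F face_of Q \<longrightarrow> F \<noteq> Q \<longrightarrow> (\<exists>d. d simplex F))"

definition vertices_of :: "'a::euclidean_space set \<Rightarrow> 'a set" where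
  "vertices_of Q = {x. x extreme_point_of Q}"

text \<open>Faces of the polytope are recorded by their vertex sets.\<close>

definition boundary_complex :: "'a::euclidean_space set \<Rightarrow> 'a abstract_complex" where
  "boundary_complex Q = (vertices_of Q, {vertices_of F | F. F face_of Q \<and> F \<noteq> Q})"

text \<open>The hyperplane \<open>a \<bullet> x = b\<close> below is a supporting hyperplane of \<open>Q\<close> cutting out \<open>G\<close>. When \<open>G\<close>
  is a facet and \<open>v\<close> lies in the affine hull of \<open>Q\<close>, the outcome does not depend on the choice of
  \<open>a\<close> and \<open>b\<close>; for full-dimensional \<open>Q\<close> the hyperplane itself is unique.\<close>

definition beyond :: "'a::euclidean_space set \<Rightarrow> 'a set \<Rightarrow> 'a \<Rightarrow> bool" where
  "beyond Q G v \<longleftrightarrow>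
     (\<exists>a b. Q \<subseteq> {x. a \<bullet> x \<le> b} \<and> G = Q \<inter> {x. a \<bullet> x = b} \<and> a \<bullet> v > b)"

definition beneath :: "'a::euclidean_space set \<Rightarrow> 'a set \<Rightarrow> 'a \<Rightarrow> bool" where
  "beneath Q G v \<longleftrightarrow>
     (\<exists>a b. Q \<subseteq> {x. a \<bullet> x \<le> b} \<and> G = Q \<inter> {x. a \<bullet> x = b} \<and> a \<bullet> v < b)"

definition stellar_point :: "'a::euclidean_space set \<Rightarrow> 'a set \<Rightarrow> 'a \<Rightarrow> bool" where
  "stellar_point Q F v \<longleftrightarrow>
     v \<in> affine hull Q \<and>
     (\<forall>G. G facet_of Q \<longrightarrow> (if F \<subseteq> G then beyond Q G v else beneath Q G v))"

definition stellar_subdivision :: "'a::euclidean_space set \<Rightarrow> 'a \<Rightarrow> 'a set" where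
  "stellar_subdivision Q v = convex hull (Q \<union> {v})"

definition cross_polytope :: "(real ^ 'n) set" where
  "cross_polytope = convex hull (range (\<lambda>i. axis i 1) \<union> range (\<lambda>i. - axis i 1))"

definition singleton_vertices :: "('n label \<Rightarrow> real ^ 'n) \<Rightarrow> 'n set \<Rightarrow> (real ^ 'n) set" where
  "singleton_vertices lab I = (\<lambda>i. lab (Block {i})) ` I"

text \<open>\<open>subdivision_run Is Q lab\<close>: starting from the cross polytope and subdividing successively for
  the sets in the list \<open>Is\<close>, with some admissible choice of the new points, one can arrive at the
  polytope \<open>Q\<close> with vertex labelling \<open>lab\<close>. The labelling is a total function whose value at a
  label not yet in use is arbitrary.\<close>

inductive subdivision_run ::
    "'n::finite set list \<Rightarrow> (real ^ 'n) set \<Rightarrow> ('n label \<Rightarrow> real ^ 'n) \<Rightarrow> bool" where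
  start: "subdivision_run [] cross_polytope lab"
    if "\<And>i. lab (Block {i}) = axis i 1" and "\<And>i. lab (Formal i) = - axis i 1"
| step: "subdivision_run (Is @ [I]) (stellar_subdivision Q v) (lab(Block I := v))"
    if "subdivision_run Is Q lab"
      and "singleton_vertices lab I \<in> snd (boundary_complex Q)"
      and "stellar_point Q (convex hull (singleton_vertices lab I)) v"

end

theory Submission
  imports Defs
begin

text \<open>
  Geometry: a face of a polytope is cut out by a supporting hyperplane, so everything is expressed
  by linear functionals on the finite vertex set. If \<open>v\<close> is beyond exactly the facets containing
  the face \<open>S\<close>, then reflecting \<open>v\<close> through a relative interior point of \<open>S\<close> shows that every
  functional supporting a face that contains \<open>S\<close> is exceeded at \<open>v\<close>; conversely, supporting
  functionals of the new faces are obtained by adding a multiple of a facet functional that is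
  negative or positive at \<open>v\<close>.

  Combinatorics: let \<open>B\<close> and \<open>B \<union> {I}\<close> be building sets such that every member of \<open>B\<close> smaller
  than \<open>I\<close> is a singleton. Then the extended nested complex of \<open>B \<union> {I}\<close> is the stellar subdivision
  of the one of \<open>B\<close> on \<open>{{i} | i \<in> I}\<close>. When the blocks are listed by decreasing cardinality, the
  singletons together with any initial segment form a building set, since the union of two
  intersecting blocks is one of them or strictly larger than both. So each subdivision adds one
  block, starting from the cross polytope, which realises the complex of the singletons.
\<close>

section \<open>Adding a block to a building set\<close>

lemma extended_nested_collectionI:
  assumes "\<sigma> \<subseteq> Block ` B \<union> Formal ` X"
    and "\<And>I J. Block I \<in> \<sigma> \<Longrightarrow> Block J \<in> \<sigma> \<Longrightarrow> I \<subseteq> J \<or> J \<subseteq> I \<or> I \<inter> J = {}"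
    and "\<And>C. Block ` C \<subseteq> \<sigma> \<Longrightarrow> card C \<ge> 2 \<Longrightarrow> pairwise disjnt C \<Longrightarrow> \<Union>C \<notin> B"
    and "\<And>i I. Formal i \<in> \<sigma> \<Longrightarrow> Block I \<in> \<sigma> \<Longrightarrow> i \<notin> I"
  shows "extended_nested_collection X B \<sigma>"
  unfolding extended_nested_collection_def by (intro conjI allI impI assms)

lemma extended_nested_collectionD:
  assumes "extended_nested_collection X B \<sigma>"
  shows "\<sigma> \<subseteq> Block ` B \<union> Formal ` X"
    and "Block I \<in> \<sigma> \<Longrightarrow> Block J \<in> \<sigma> \<Longrightarrow> I \<subseteq> J \<or> J \<subseteq> I \<or> I \<inter> J = {}"
    and "Block ` C \<subseteq> \<sigma> \<Longrightarrow> card C \<ge> 2 \<Longrightarrow> pairwise disjnt C \<Longrightarrow> \<Union>C \<notin> B"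
    and "Formal i \<in> \<sigma> \<Longrightarrow> Block I \<in> \<sigma> \<Longrightarrow> i \<notin> I"
  using assms unfolding extended_nested_collection_def by simp_all

text \<open>Apart from the choice of labels, every condition is a prohibition, and a smaller
  collection with a smaller building set has fewer of them to meet.\<close>

lemma extended_nested_collection_mono:
  assumes "extended_nested_collection X B \<sigma>" "\<tau> \<subseteq> \<sigma>" "\<tau> \<subseteq> Block ` B' \<union> Formal ` X" "B' \<subseteq> B"
  shows "extended_nested_collection X B' \<tau>"
proof (rule extended_nested_collectionI)
  note D = extended_nested_collectionD[OF assms(1)]
  show "I \<subseteq> J \<or> J \<subseteq> I \<or> I \<inter> J = {}" if "Block I \<in> \<tau>" "Block J \<in> \<tau>" for I J
    using D(2) that assms(2) by blast
  show "\<Union>C \<notin> B'" if "Block ` C \<subseteq> \<tau>" "card C \<ge> 2" "pairwise disjnt C" for C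
    using D(3)[of C] that assms(2,4) by (meson order_trans subsetD)
  show "i \<notin> I" if "Formal i \<in> \<tau>" "Block I \<in> \<tau>" for i I
    using D(4) that assms(2) by blast
qed (rule assms(3))

text \<open>Serves to rule out disjoint families whose union is a singleton block. The empty set
  must be excluded, since \<open>{{}, {j}}\<close> has two members and union
  \<open>{j}\<close>.\<close>

lemma card_le_1_if_Union_singleton:
  assumes "{} \<notin> C" "\<Union>C = {j}"
  shows "card C \<le> 1"
proof -
  have "C \<subseteq> {{j}}"
  proof
    fix J assume J: "J \<in> C"
    then have "J \<subseteq> {j}" "J \<noteq> {}" using assms by (blast, metis)
    then show "J \<in> {{j}}" by blast
  qed
  then show ?thesis using card_mono[of "{{j}}" C] by simp
qed

text \<open>One step of the construction. The assumption \<open>small\<close> is the trace of the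
  ordering by decreasing cardinality: the non-singleton members of \<open>B\<close> are at least as
  large as \<open>I\<close>.\<close>

locale building_set_extension =
  fixes X :: "'a set" and B I
  assumes B: "building_set X B" and B': "building_set X (insert I B)"
    and I_new: "I \<notin> B" and small: "\<And>J. J \<in> B \<Longrightarrow> card J < card I \<Longrightarrow> is_singleton J"
begin

abbreviation "N \<equiv> extended_nested_collection X B"
abbreviation "N' \<equiv> extended_nested_collection X (insert I B)"
abbreviation "D \<equiv> (\<lambda>i. Block {i}) ` I"

lemma finite_X: "finite X" and I_sub: "I \<subseteq> X" and I_ne: "I \<noteq> {}" and B_sub: "B \<subseteq> Pow X"
  and B_ne: "{} \<notin> B"
  using B B' by (auto simp: building_set_def)

lemma finite_I: "finite I" using finite_X I_sub finite_subset by blast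

lemma singleton_in_B: "i \<in> X \<Longrightarrow> {i} \<in> B"
  using B by (simp add: building_set_def)

lemma card_I: "card I \<ge> 2"
proof (rule ccontr)
  assume "\<not> card I \<ge> 2"
  then have "card I = 1" using finite_I I_ne by (cases "card I" rule: nat.exhaust) (auto simp: not_le less_Suc_eq)
  then obtain i where "I = {i}" by (auto simp: card_1_singleton_iff)
  then show False using singleton_in_B I_sub I_new by auto
qed

text \<open>The union is a block of \<open>insert I B\<close> and differs from \<open>I\<close>, so
  it already lies in \<open>B\<close>.\<close>

lemma union_in_B:
  assumes "J \<in> B" "J \<inter> I \<noteq> {}" "\<not> J \<subseteq> I"
  shows "J \<union> I \<in> B"
  using B' assms by (auto simp: building_set_def)

text \<open>Since \<open>I \<notin> B\<close>, the inclusion is proper, so \<open>J\<close> has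
  fewer elements than \<open>I\<close>.\<close>

lemma subset_I_singleton: "J \<in> B \<Longrightarrow> J \<subseteq> I \<Longrightarrow> is_singleton J"
  using small psubset_card_mono[OF finite_I, of J] I_new by blast

lemma D_disjoint_union:
  "Block ` (\<lambda>i. {i}) ` I = D" "card ((\<lambda>i. {i}) ` I) \<ge> 2" "pairwise disjnt ((\<lambda>i. {i}) ` I)"
  "\<Union>((\<lambda>i. {i}) ` I) = I"
  using card_I by (auto simp: card_image pairwise_def disjnt_def)

text \<open>The members of \<open>C\<close> are blocks inside \<open>I\<close>, hence singletons. So
  the one new instance of the disjoint union condition, that for the union \<open>I\<close>, forbids
  exactly the supersets of \<open>D\<close>.\<close>

lemma disjoint_union_I_imp_D:
  assumes \<sigma>: "Block ` C \<subseteq> Block ` B \<union> Formal ` X" and C: "card C \<ge> 2" "pairwise disjnt C" "\<Union>C = I"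
  shows "D \<subseteq> Block ` C"
proof
  fix x assume "x \<in> D"
  then obtain i where i: "i \<in> I" "x = Block {i}" by blast
  then obtain J where J: "J \<in> C" "i \<in> J" using C(3) by blast
  then have "J \<in> B" using \<sigma> by blast
  then have "is_singleton J" using subset_I_singleton J C(3) by blast
  then have "J = {i}" using J(2) by (auto simp: is_singleton_def)
  then show "x \<in> Block ` C" using i J by blast
qed

lemma D_not_subset:
  assumes "N' \<sigma>"
  shows "\<not> D \<subseteq> \<sigma>"
proof
  assume "D \<subseteq> \<sigma>"
  then have "\<Union>((\<lambda>i. {i}) ` I) \<notin> insert I B"
    using D_disjoint_union by (intro extended_nested_collectionD(3)[OF assms]) auto
  then show False using D_disjoint_union(4) by simp
qed

lemma old_faces:
  assumes "Block I \<notin> \<sigma>"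
  shows "N' \<sigma> \<longleftrightarrow> N \<sigma> \<and> \<not> D \<subseteq> \<sigma>"
proof
  assume n: "N' \<sigma>"
  have "\<sigma> \<subseteq> Block ` B \<union> Formal ` X"
    using assms extended_nested_collectionD(1)[OF n] by auto
  then have "N \<sigma>" by (intro extended_nested_collection_mono[OF n]) auto
  then show "N \<sigma> \<and> \<not> D \<subseteq> \<sigma>" using D_not_subset[OF n] by simp
next
  assume n: "N \<sigma> \<and> \<not> D \<subseteq> \<sigma>"
  note E = extended_nested_collectionD[OF conjunct1[OF n]]
  show "N' \<sigma>"
  proof (rule extended_nested_collectionI)
    show "\<sigma> \<subseteq> Block ` insert I B \<union> Formal ` X" using E(1) by auto
    show "\<Union>C \<notin> insert I B" if C: "Block ` C \<subseteq> \<sigma>" "card C \<ge> 2" "pairwise disjnt C" for C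
    proof -
      have "\<Union>C \<noteq> I"
        using disjoint_union_I_imp_D[of C] n C E(1) by (metis subset_trans)
      then show ?thesis using E(3)[OF C] by simp
    qed
  qed (rule E; assumption)+
qed

text \<open>A disjoint family with union in \<open>B\<close> that uses some \<open>{i}\<close> with \<open>i \<in> I\<close> is turned into a family
  for the larger building set by replacing all its members inside \<open>I\<close> with \<open>I\<close> itself.\<close>

lemma link_of_new_face:
  assumes n: "N' (insert (Block I) \<tau>)" and notin: "Block I \<notin> \<tau>"
  shows "N (\<tau> \<union> D)"
proof (rule extended_nested_collectionI)
  let ?\<sigma> = "insert (Block I) \<tau>"
  note E = extended_nested_collectionD[OF n]
  have sub: "\<tau> \<subseteq> Block ` B \<union> Formal ` X"
    using E(1) notin by auto
  then show "\<tau> \<union> D \<subseteq> Block ` B \<union> Formal ` X"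
    using singleton_in_B I_sub by auto
  have nest: "J \<subseteq> I \<or> I \<subseteq> J \<or> J \<inter> I = {}" if "Block J \<in> \<tau>" for J
    using E(2)[of J I] that by simp
  show "J \<subseteq> L \<or> L \<subseteq> J \<or> J \<inter> L = {}" if "Block J \<in> \<tau> \<union> D" "Block L \<in> \<tau> \<union> D" for J L
  proof (cases "Block J \<in> \<tau> \<and> Block L \<in> \<tau>")
    case True
    then show ?thesis using E(2)[of J L] by simp
  next
    case False
    then have "is_singleton J \<or> is_singleton L" using that by (auto simp: is_singleton_def)
    then show ?thesis by (auto simp: is_singleton_def)
  qed
  \<comment> \<open>If \<open>J\<close> is some \<open>{j}\<close> with \<open>j \<in> I\<close>,
    then \<open>Formal i\<close> and \<open>Block I\<close> lying in one collection give
    \<open>i \<notin> I\<close>.\<close>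
  show "i \<notin> J" if "Formal i \<in> \<tau> \<union> D" "Block J \<in> \<tau> \<union> D" for i J
    using E(4)[of i J] E(4)[of i I] that by auto
  show "\<Union>C \<notin> B" if C: "Block ` C \<subseteq> \<tau> \<union> D" "card C \<ge> 2" "pairwise disjnt C" for C
  proof
    assume U: "\<Union>C \<in> B"
    show False
    proof (cases "Block ` C \<subseteq> \<tau>")
      case True
      then have "\<Union>C \<notin> insert I B" using C by (intro E(3)) auto
      then show False using U by simp
    next
      case False
      then obtain i where i: "i \<in> I" "{i} \<in> C" using C(1) by blast
      have CB: "C \<subseteq> B" using C(1) sub singleton_in_B I_sub by auto
      \<comment> \<open>A member containing \<open>I\<close> would meet \<open>{i}\<close>, hence
        equal it, although \<open>I\<close> has at least two elements.\<close>
      have C_cases: "J \<subseteq> I \<or> J \<inter> I = {}" if J: "J \<in> C" for J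
      proof -
        have "J \<subseteq> I \<or> I \<subseteq> J \<or> J \<inter> I = {}" using nest C(1) J by blast
        moreover have "\<not> I \<subseteq> J"
        proof
          assume "I \<subseteq> J"
          then have "J \<inter> {i} \<noteq> {}" using i by auto
          then have "J = {i}" using pairwiseD[OF C(3) J i(2)] by (auto simp: disjnt_def)
          then show False using \<open>I \<subseteq> J\<close> card_I card_mono[of "{i}" I] by auto
        qed
        ultimately show ?thesis by blast
      qed
      show False
      proof (cases "\<Union>C \<subseteq> I")
        case True
        then have "is_singleton (\<Union>C)" by (rule subset_I_singleton[OF U])
        then obtain j where j: "\<Union>C = {j}" by (auto simp: is_singleton_def)
        have "{} \<notin> C" using CB B_ne by (rule contra_subsetD)
        then show False using C(2) card_le_1_if_Union_singleton[OF _ j] by simp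
      next
        case False
        let ?C = "insert I {J \<in> C. J \<inter> I = {}}"
        \<comment> \<open>This \<open>J\<close> survives the replacement, so \<open>?C\<close> still
          has two members.\<close>
        obtain J where J: "J \<in> C" "\<not> J \<subseteq> I" using False by auto
        then have JI: "J \<inter> I = {}" using C_cases by blast
        have finC: "finite C" using C(2) card.infinite by fastforce
        have "card {I, J} \<le> card ?C" using finC J JI by (intro card_mono) auto
        moreover have "I \<noteq> J" using JI I_ne by auto
        ultimately have "card ?C \<ge> 2" by simp
        moreover have "pairwise disjnt ?C"
          using C(3) by (auto simp: pairwise_def disjnt_def)
        moreover have "Block ` ?C \<subseteq> ?\<sigma>"
          using C(1) by auto
        moreover have "\<Union>?C = \<Union>C \<union> I" using C_cases by blast
        then have "\<Union>?C \<in> insert I B" using union_in_B[OF U] i False by auto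
        ultimately show False
          using E(3)[of ?C] by simp
      qed
    qed
  qed
qed

text \<open>Here \<open>I\<close> is conversely broken up into its singletons; \<open>I\<close> crossing some \<open>J\<close> is excluded by the
  family consisting of \<open>J\<close> and the singletons of \<open>I - J\<close>.\<close>

lemma new_face_of_join:
  assumes n: "N (\<tau> \<union> D)" and D: "\<not> D \<subseteq> \<tau>"
  shows "N' (insert (Block I) \<tau>)"
proof (rule extended_nested_collectionI)
  let ?\<sigma> = "insert (Block I) \<tau>"
  note E = extended_nested_collectionD[OF n]
  have sub: "\<tau> \<subseteq> Block ` B \<union> Formal ` X"
    using E(1) by simp
  then show "?\<sigma> \<subseteq> Block ` insert I B \<union> Formal ` X" by auto
  have nest: "J \<subseteq> I \<or> I \<subseteq> J \<or> J \<inter> I = {}" if J: "Block J \<in> \<tau>" for J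
  proof (rule ccontr)
    assume no: "\<not> (J \<subseteq> I \<or> I \<subseteq> J \<or> J \<inter> I = {})"
    then obtain i where i: "i \<in> I" "i \<notin> J" by blast
    have JB: "J \<in> B" using sub J by blast
    let ?C = "insert J ((\<lambda>i. {i}) ` (I - J))"
    have "card {J, {i}} \<le> card ?C" using i finite_I by (intro card_mono) auto
    moreover have "J \<noteq> {i}" using i by auto
    ultimately have "card ?C \<ge> 2" by simp
    moreover have "pairwise disjnt ?C" by (auto simp: pairwise_def disjnt_def)
    moreover have "Block ` ?C \<subseteq> \<tau> \<union> D" using J by auto
    moreover have "\<Union>?C = J \<union> I" by auto
    then have "\<Union>?C \<in> B" using union_in_B[OF JB] no by auto
    ultimately show False using E(3)[of ?C] by simp
  qed
  show "J \<subseteq> L \<or> L \<subseteq> J \<or> J \<inter> L = {}" if "Block J \<in> ?\<sigma>" "Block L \<in> ?\<sigma>" for J L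
  proof -
    have "J \<subseteq> L \<or> L \<subseteq> J \<or> J \<inter> L = {}" if "Block J \<in> \<tau>" "Block L \<in> \<tau>"
      using E(2)[of J L] that by simp
    then show ?thesis using that nest[of J] nest[of L] by auto
  qed
  \<comment> \<open>For \<open>J = I\<close>: if \<open>i \<in> I\<close>, then
    \<open>Block {i}\<close> lies in \<open>D\<close> and conflicts with
    \<open>Formal i\<close>.\<close>
  show "i \<notin> J" if "Formal i \<in> ?\<sigma>" "Block J \<in> ?\<sigma>" for i J
    using E(4)[of i J] E(4)[of i "{i}"] that by auto
  show "\<Union>C \<notin> insert I B" if C: "Block ` C \<subseteq> ?\<sigma>" "card C \<ge> 2" "pairwise disjnt C" for C
  proof
    assume U: "\<Union>C \<in> insert I B"
    have finC: "finite C" using C(2) card.infinite by fastforce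
    show False
    proof (cases "I \<in> C")
      case False
      then have C\<tau>: "Block ` C \<subseteq> \<tau>" using C(1) by auto
      then have "\<Union>C \<notin> B" using C by (intro E(3)) auto
      then have "\<Union>C = I" using U by blast
      then have "D \<subseteq> Block ` C" using C sub C\<tau> by (intro disjoint_union_I_imp_D) auto
      then have "D \<subseteq> \<tau>" using C\<tau> by (rule subset_trans)
      then show False using D by blast
    next
      case True
      let ?C = "(C - {I}) \<union> (\<lambda>i. {i}) ` I"
      have dI: "J \<inter> I = {}" if "J \<in> C" "J \<noteq> I" for J
        using C(3) True that by (auto simp: pairwise_def disjnt_def)
      have "card ((\<lambda>i. {i}) ` I) \<le> card ?C"
        using finC finite_I by (intro card_mono) auto
      then have "card ?C \<ge> 2" using D_disjoint_union(2) by linarith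
      moreover have "pairwise disjnt ?C"
        using C(3) dI by (fastforce simp: pairwise_def disjnt_def)
      moreover have "Block ` ?C \<subseteq> \<tau> \<union> D" using C(1) by auto
      moreover have eq: "\<Union>?C = \<Union>C" using True by auto
      \<comment> \<open>With this, \<open>U\<close> yields \<open>\<Union>C \<in> B\<close>. If the
        union were \<open>I\<close>, any other member would be both inside \<open>I\<close> and
        disjoint from it, hence empty.\<close>
      moreover have "\<Union>C \<noteq> I"
      proof
        assume UI: "\<Union>C = I"
        have "C \<subseteq> {I}"
        proof
          fix J assume J: "J \<in> C"
          show "J \<in> {I}"
          proof (rule ccontr)
            assume "J \<notin> {I}"
            then have "J = {}" using dI[OF J] J UI by blast
            moreover have "J \<in> B" using J C(1) sub \<open>J \<notin> {I}\<close> by auto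
            ultimately show False using B_ne by blast
          qed
        qed
        then show False using C(2) card_mono[of "{I}" C] by auto
      qed
      ultimately show False using E(3)[of ?C] U by auto
    qed
  qed
qed

text \<open>The conditions on \<open>\<tau>\<close> say that it is the union of a proper subset of
  \<open>D\<close> and a face of the link of \<open>D\<close>, as for the faces through the new
  vertex of a stellar subdivision.\<close>

lemma new_faces:
  assumes "Block I \<notin> \<tau>"
  shows "N' (insert (Block I) \<tau>) \<longleftrightarrow> N \<tau> \<and> \<not> D \<subseteq> \<tau> \<and> N (\<tau> \<union> D)"
proof
  assume n: "N' (insert (Block I) \<tau>)"
  have "N' \<tau>"
    using extended_nested_collectionD(1)[OF n]
    by (intro extended_nested_collection_mono[OF n]) auto
  then show "N \<tau> \<and> \<not> D \<subseteq> \<tau> \<and> N (\<tau> \<union> D)"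
    using old_faces[OF assms] link_of_new_face[OF n assms] by blast
qed (use new_face_of_join in blast)

text \<open>A block that is a union of members of \<open>D\<close> lies inside \<open>I\<close> and
  is therefore a singleton. This is why the subdivision at \<open>I\<close> is well defined.\<close>

lemma singletons_nested: "N D"
proof (rule extended_nested_collectionI)
  show "D \<subseteq> Block ` B \<union> Formal ` X" using singleton_in_B I_sub by auto
  show "\<Union>C \<notin> B" if C: "Block ` C \<subseteq> D" "card C \<ge> 2" "pairwise disjnt C" for C
  proof
    assume U: "\<Union>C \<in> B"
    have "\<Union>C \<subseteq> I" using C(1) by auto
    then obtain j where j: "\<Union>C = {j}" using subset_I_singleton[OF U] by (auto simp: is_singleton_def)
    have "{} \<notin> C" using C(1) by auto
    then show False using C(2) card_le_1_if_Union_singleton[OF _ j] by simp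
  qed
qed auto

lemma complex_iso_stellar:
  assumes iso: "complex_iso f (extended_nested_complex X B) (V, K)"
    and K: "K \<subseteq> Pow V" and v: "v \<notin> V"
    and K': "K' = {\<sigma> \<in> K. \<not> f ` D \<subseteq> \<sigma>} \<union>
               {insert v \<tau> | \<tau>. \<tau> \<in> K \<and> \<not> f ` D \<subseteq> \<tau> \<and> \<tau> \<union> f ` D \<in> K}"
  shows "complex_iso (f(Block I := v)) (extended_nested_complex X (insert I B)) (insert v V, K')"
proof -
  let ?L = "Block ` B \<union> Formal ` X" and ?f = "f(Block I := v)"
  have bij: "bij_betw f ?L V" and faces: "\<And>\<sigma>. \<sigma> \<subseteq> ?L \<Longrightarrow> N \<sigma> \<longleftrightarrow> f ` \<sigma> \<in> K"
    using iso by (auto simp: complex_iso_def extended_nested_complex_def)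
  have I: "Block I \<notin> ?L" using I_new by auto
  have DL: "D \<subseteq> ?L" using singleton_in_B I_sub by auto
  have D_iff: "f ` D \<subseteq> f ` \<tau> \<longleftrightarrow> D \<subseteq> \<tau>" if "\<tau> \<subseteq> ?L" for \<tau>
    using bij DL that by (intro inj_on_image_subset_iff) (auto simp: bij_betw_def)
  have f_eq: "?f ` \<tau> = f ` \<tau>" if "\<tau> \<subseteq> ?L" for \<tau>
    using that I by (intro image_cong) auto
  have fV: "f ` \<tau> \<subseteq> V" if "\<tau> \<subseteq> ?L" for \<tau>
    using bij that by (auto simp: bij_betw_def)
  have vK: "v \<notin> \<rho>" if "\<rho> \<in> K" for \<rho>
    using K v that by blast
  have "bij_betw ?f ?L V"
    using bij I by (subst bij_betw_cong[of ?L ?f f]) auto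
  then have "bij_betw ?f (?L \<union> {Block I}) (V \<union> {v})"
    using notIn_Un_bij_betw[of "Block I" ?L ?f V] I v by simp
  moreover have "N' \<sigma> \<longleftrightarrow> ?f ` \<sigma> \<in> K'" if \<sigma>: "\<sigma> \<subseteq> insert (Block I) ?L" for \<sigma>
  proof (cases "Block I \<in> \<sigma>")
    case False
    then have \<sigma>L: "\<sigma> \<subseteq> ?L" using \<sigma> by blast
    have "v \<notin> f ` \<sigma>" using fV[OF \<sigma>L] v by blast
    then have "f ` \<sigma> \<in> K' \<longleftrightarrow> f ` \<sigma> \<in> K \<and> \<not> f ` D \<subseteq> f ` \<sigma>"
      unfolding K' by blast
    then show ?thesis
      using old_faces[OF False] faces[OF \<sigma>L] D_iff[OF \<sigma>L] f_eq[OF \<sigma>L] by simp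
  next
    case True
    define \<tau> where "\<tau> = \<sigma> - {Block I}"
    have \<tau>: "\<sigma> = insert (Block I) \<tau>" "\<tau> \<subseteq> ?L" "Block I \<notin> \<tau>"
      using True \<sigma> by (auto simp: \<tau>_def)
    have im: "?f ` \<sigma> = insert v (f ` \<tau>)" unfolding \<tau>(1) image_insert f_eq[OF \<tau>(2)] by simp
    have "v \<notin> f ` \<tau>" using fV[OF \<tau>(2)] v by blast
    \<comment> \<open>As \<open>v\<close> lies in no old face, an old face can be recovered after
      \<open>v\<close> has been inserted.\<close>
    then have inj: "\<rho> = f ` \<tau>" if "insert v (f ` \<tau>) = insert v \<rho>" "\<rho> \<in> K" for \<rho>
      using that vK[OF that(2)] by (simp add: insert_ident)
    have "insert v (f ` \<tau>) \<notin> K" by (auto dest: vK)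
    then have "insert v (f ` \<tau>) \<in> K' \<longleftrightarrow> (\<exists>\<rho>. insert v (f ` \<tau>) = insert v \<rho> \<and>
        \<rho> \<in> K \<and> \<not> f ` D \<subseteq> \<rho> \<and> \<rho> \<union> f ` D \<in> K)"
      unfolding K' by simp
    also have "\<dots> \<longleftrightarrow> f ` \<tau> \<in> K \<and> \<not> f ` D \<subseteq> f ` \<tau> \<and> f ` \<tau> \<union> f ` D \<in> K"
      using inj by metis
    also have "\<dots> \<longleftrightarrow> N \<tau> \<and> \<not> D \<subseteq> \<tau> \<and> N (\<tau> \<union> D)"
      using faces[OF \<tau>(2)] faces[of "\<tau> \<union> D"] D_iff[OF \<tau>(2)] \<tau>(2) DL by (simp add: image_Un)
    also have "\<dots> \<longleftrightarrow> N' \<sigma>"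
      using new_faces[OF \<tau>(3)] \<tau>(1) by simp
    finally show ?thesis using im by simp
  qed
  ultimately show ?thesis
    unfolding complex_iso_def extended_nested_complex_def by simp
qed

end

section \<open>The boundary complex in terms of supporting functionals\<close>

text \<open>A proper face of \<open>convex hull V\<close>, recorded by the points of
  \<open>V\<close> on a supporting hyperplane. Taking \<open>a = 0\<close> and \<open>b > 0\<close>
  gives the empty face.\<close>

definition exposed_subset :: "'a::real_inner set \<Rightarrow> 'a set \<Rightarrow> bool" where
  "exposed_subset V \<sigma> \<longleftrightarrow>
     \<sigma> \<subset> V \<and> (\<exists>a b. (\<forall>w\<in>V. a \<bullet> w \<le> b) \<and> \<sigma> = {w \<in> V. a \<bullet> w = b})"

text \<open>The face cut out by the hyperplane is the hull of some \<open>W \<subseteq> V\<close>,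
  and \<open>W\<close> lies on the hyperplane, so \<open>W \<subseteq> \<sigma>\<close>. A point of
  \<open>V\<close> off the hyperplane shows that the face is proper.\<close>

lemma exposed_subset_imp_face:
  fixes V :: "'a::euclidean_space set"
  assumes "finite V" "exposed_subset V \<sigma>"
  shows "convex hull \<sigma> face_of convex hull V" "convex hull \<sigma> \<noteq> convex hull V"
proof -
  obtain a b where ab: "\<forall>w\<in>V. a \<bullet> w \<le> b" "\<sigma> = {w \<in> V. a \<bullet> w = b}" and pr: "\<sigma> \<subset> V"
    using assms(2) by (auto simp: exposed_subset_def)
  have sub: "convex hull V \<subseteq> {x. a \<bullet> x \<le> b}"
    using ab(1) by (intro hull_minimal) (auto simp: convex_halfspace_le)
  have sub': "convex hull \<sigma> \<subseteq> {x. a \<bullet> x = b}"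
    using ab(2) by (intro hull_minimal) (auto simp: convex_hyperplane)
  have face: "(convex hull V \<inter> {x. a \<bullet> x = b}) face_of convex hull V"
    using sub by (intro face_of_Int_supporting_hyperplane_le) auto
  then obtain W where W: "W \<subseteq> V" "convex hull V \<inter> {x. a \<bullet> x = b} = convex hull W"
    using face_of_convex_hull_subset[OF finite_imp_compact[OF assms(1)]] by metis
  then have "W \<subseteq> \<sigma>"
    using ab(2) hull_subset[of W convex] by blast
  then have "convex hull W \<subseteq> convex hull \<sigma>"
    by (rule hull_mono)
  moreover have "convex hull \<sigma> \<subseteq> convex hull W"
    using sub' hull_mono[of \<sigma> V convex] pr W(2) by blast
  ultimately show "convex hull \<sigma> face_of convex hull V"
    using face W(2) by (metis subset_antisym)
  obtain w where "w \<in> V" "w \<notin> \<sigma>" using pr by auto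
  then show "convex hull \<sigma> \<noteq> convex hull V"
    using sub' ab(2) hull_inc[of w V convex] by blast
qed

lemma finite_vertices_of: "polytope Q \<Longrightarrow> finite (vertices_of Q)"
  unfolding vertices_of_def
  by (simp add: finite_polyhedron_extreme_points polytope_imp_polyhedron)

lemma polytope_eq_convex_hull_vertices: "polytope Q \<Longrightarrow> Q = convex hull vertices_of Q"
  unfolding vertices_of_def
  by (simp add: Krein_Milman_Minkowski polytope_imp_compact polytope_imp_convex)

lemma vertices_of_face: "T face_of Q \<Longrightarrow> vertices_of T = vertices_of Q \<inter> T"
  unfolding vertices_of_def using extreme_point_of_face by blast

lemma vertices_of_subset: "vertices_of Q \<subseteq> Q"
  unfolding vertices_of_def extreme_point_of_def by blast

lemma face_eq_convex_hull_vertices: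
  assumes "polytope Q" "T face_of Q"
  shows "T = convex hull (vertices_of Q \<inter> T)"
  using polytope_eq_convex_hull_vertices[OF face_of_polytope_polytope[OF assms]]
    vertices_of_face[OF assms(2)] by simp

lemma boundary_complex_iff_exposed:
  assumes Q: "polytope Q"
  shows "\<sigma> \<in> snd (boundary_complex Q) \<longleftrightarrow> exposed_subset (vertices_of Q) \<sigma>"
proof
  let ?V = "vertices_of Q"
  assume "\<sigma> \<in> snd (boundary_complex Q)"
  then obtain T where T: "T face_of Q" "T \<noteq> Q" "\<sigma> = ?V \<inter> T"
    unfolding boundary_complex_def using vertices_of_face by auto
  have "T exposed_face_of Q"
    using T Q by (simp add: exposed_face_of_polyhedron polytope_imp_polyhedron)
  then obtain a b where ab: "Q \<subseteq> {x. a \<bullet> x \<le> b}" "T = Q \<inter> {x. a \<bullet> x = b}"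
    unfolding exposed_face_of_def by blast
  have "\<sigma> \<noteq> ?V"
    using T face_eq_convex_hull_vertices[OF Q T(1)] polytope_eq_convex_hull_vertices[OF Q] by auto
  with ab T(3) vertices_of_subset[of Q] show "exposed_subset ?V \<sigma>"
    unfolding exposed_subset_def by (intro conjI exI[of _ a] exI[of _ b]) auto
next
  let ?V = "vertices_of Q"
  assume ex: "exposed_subset ?V \<sigma>"
  note face = exposed_subset_imp_face[OF finite_vertices_of[OF Q] ex,
      folded polytope_eq_convex_hull_vertices[OF Q]]
  obtain a b where ab: "\<sigma> = {w \<in> ?V. a \<bullet> w = b}"
    using ex unfolding exposed_subset_def by blast
  have "convex hull \<sigma> \<subseteq> {x. a \<bullet> x = b}"
    using ab by (intro hull_minimal) (auto simp: convex_hyperplane)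
  then have "?V \<inter> convex hull \<sigma> = \<sigma>"
    using ab hull_subset[of \<sigma> convex] by blast
  with face show "\<sigma> \<in> snd (boundary_complex Q)"
    unfolding boundary_complex_def using vertices_of_face by force
qed

lemma vertices_of_convex_hull:
  assumes "finite V" "\<And>w. w \<in> V \<Longrightarrow> exposed_subset V {w}"
  shows "vertices_of (convex hull V) = V"
proof
  show "vertices_of (convex hull V) \<subseteq> V"
    unfolding vertices_of_def using extreme_point_of_convex_hull by blast
  show "V \<subseteq> vertices_of (convex hull V)"
    unfolding vertices_of_def
    using exposed_subset_imp_face(1)[OF assms(1) assms(2)] by (auto simp: face_of_singleton)
qed

lemma boundary_complex_face:
  assumes "polytope Q" "\<sigma> \<in> snd (boundary_complex Q)"
  shows "convex hull \<sigma> face_of Q" "convex hull \<sigma> \<noteq> Q" "\<sigma> \<subset> vertices_of Q"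
  using assms exposed_subset_imp_face[OF finite_vertices_of[OF assms(1)], of \<sigma>]
    polytope_eq_convex_hull_vertices[OF assms(1)]
  by (auto simp: boundary_complex_iff_exposed exposed_subset_def)

text \<open>The affinely independent set spanning a simplex is its set of extreme points, so being
  simplicial can be read off the vertex sets of the faces.\<close>

lemma simplicial_polytope_iff:
  "simplicial_polytope Q \<longleftrightarrow>
     polytope Q \<and> (\<forall>\<sigma>\<in>snd (boundary_complex Q). \<not> affine_dependent \<sigma>)"
proof (intro iffI conjI ballI)
  fix \<sigma> assume Q: "simplicial_polytope Q" and "\<sigma> \<in> snd (boundary_complex Q)"
  then obtain T where T: "T face_of Q" "T \<noteq> Q" "\<sigma> = vertices_of T"
    unfolding boundary_complex_def by auto
  then obtain C where C: "\<not> affine_dependent C" "T = convex hull C"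
    using Q unfolding simplicial_polytope_def simplex_def by metis
  then have "\<sigma> = C"
    unfolding T(3) vertices_of_def by (auto simp: extreme_point_of_convex_hull_affine_independent)
  then show "\<not> affine_dependent \<sigma>" using C by simp
next
  assume Q: "polytope Q \<and> (\<forall>\<sigma>\<in>snd (boundary_complex Q). \<not> affine_dependent \<sigma>)"
  have "\<exists>d. d simplex F" if "F face_of Q" "F \<noteq> Q" for F
  proof -
    have "F = convex hull (vertices_of F)"
      using Q that polytope_eq_convex_hull_vertices face_of_polytope_polytope by blast
    moreover have "\<not> affine_dependent (vertices_of F)"
      using Q that unfolding boundary_complex_def by auto
    ultimately show ?thesis
      unfolding simplex_def by (metis diff_add_cancel)
  qed
  then show "simplicial_polytope Q"
    using Q unfolding simplicial_polytope_def by blast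
qed (simp add: simplicial_polytope_def)

text \<open>A subset of an affinely independent set spans a face of the simplex, and a face of a
  face is a face.\<close>

lemma boundary_complex_subset:
  assumes Q: "simplicial_polytope Q" and "\<sigma> \<in> snd (boundary_complex Q)" "\<tau> \<subseteq> \<sigma>"
  shows "\<tau> \<in> snd (boundary_complex Q)"
proof -
  have P: "polytope Q" and ind: "\<not> affine_dependent \<sigma>"
    using assms by (auto simp: simplicial_polytope_iff)
  note f = boundary_complex_face[OF P assms(2)]
  have "convex hull \<tau> face_of convex hull \<sigma>"
    using ind assms(3) face_of_convex_hull_affine_independent by blast
  then have face: "convex hull \<tau> face_of Q"
    using f(1) face_of_trans by blast
  have "\<not> affine_dependent \<tau>"
    using ind assms(3) affine_dependent_subset by blast
  then have "vertices_of (convex hull \<tau>) = \<tau>"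
    unfolding vertices_of_def by (auto simp: extreme_point_of_convex_hull_affine_independent)
  moreover have "convex hull \<tau> \<noteq> Q"
    using f hull_mono[OF assms(3)] face_of_imp_subset by blast
  ultimately show ?thesis
    unfolding boundary_complex_def using face by force
qed

section \<open>Facets, interior points and the existence of stellar points\<close>

lemma facet_supporting_hyperplane:
  assumes "polytope Q" "G facet_of Q"
  obtains a b where "Q \<subseteq> {x. a \<bullet> x \<le> b}" "G = Q \<inter> {x. a \<bullet> x = b}"
  using assms
  by (metis exposed_face_of_def exposed_face_of_polyhedron facet_of_imp_face_of polytope_imp_polyhedron)

lemma supporting_hyperplane_interior_less:
  assumes "Q \<subseteq> {x. a \<bullet> x \<le> b}" "a \<noteq> 0" "p \<in> interior Q"
  shows "a \<bullet> p < b"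
  using interior_mono[OF assms(1)] interior_halfspace_le[OF assms(2)] assms(3) by blast

text \<open>Otherwise the segment from an interior point \<open>p\<close> to \<open>x\<close> meets
  the frontier in a point \<open>y\<close> of some facet. As \<open>x\<close> is strictly beneath
  that facet and \<open>p\<close> is not beyond it, \<open>y\<close> cannot lie on its
  hyperplane.\<close>

lemma beneath_all_facets_imp_interior:
  assumes Q: "polytope Q" "affine hull Q = UNIV"
    and ben: "\<And>G. G facet_of Q \<Longrightarrow> beneath Q G x"
  shows "x \<in> interior Q"
proof (rule ccontr)
  assume x: "x \<notin> interior Q"
  have frontier: "\<exists>G. G facet_of Q \<and> y \<in> G" if "y \<in> frontier Q" for y
  proof -
    have "y \<in> Q - rel_interior Q"
      using that Q by (simp add: rel_interior_interior frontier_def polytope_imp_closed)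
    then show ?thesis
      using rel_boundary_of_polyhedron[OF polytope_imp_polyhedron[OF Q(1)]] by blast
  qed
  have "rel_interior Q \<noteq> {}"
    using Q by (metis affine_hull_empty empty_not_UNIV polytope_imp_convex rel_interior_eq_empty)
  then obtain p where p: "p \<in> interior Q"
    using Q by (auto simp: rel_interior_interior)
  obtain y where y: "y \<in> closed_segment p x" "y \<in> frontier Q"
  proof (cases "x \<in> Q")
    case True
    then have "x \<in> frontier Q"
      using x closure_subset[of Q] by (auto simp: frontier_def)
    then show ?thesis using that by auto
  next
    case False
    then have "closed_segment p x \<inter> frontier Q \<noteq> {}"
      using p interior_subset[of Q] by (intro connected_Int_frontier) auto
    then show ?thesis using that by blast
  qed
  obtain G where G: "G facet_of Q" "y \<in> G"
    using frontier y(2) by blast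
  obtain a b where ab: "Q \<subseteq> {x. a \<bullet> x \<le> b}" "G = Q \<inter> {x. a \<bullet> x = b}" "a \<bullet> x < b"
    using ben[OF G(1)] unfolding beneath_def by blast
  obtain t where t: "0 \<le> t" "t \<le> 1" "y = (1 - t) *\<^sub>R p + t *\<^sub>R x"
    using y(1) by (auto simp: in_segment)
  have "t \<noteq> 0"
    using p y(2) t(3) by (auto simp: frontier_def)
  then have "t * (a \<bullet> x) < t * b"
    using ab(3) t(1) by simp
  moreover have "(1 - t) * (a \<bullet> p) \<le> (1 - t) * b"
    using ab(1) p interior_subset[of Q] t(2) by (intro mult_left_mono) auto
  moreover have "(1 - t) * (a \<bullet> p) + t * (a \<bullet> x) = b"
    using G(2) ab(2) t(3) by (simp add: inner_right_distrib)
  ultimately show False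
    by (simp add: algebra_simps)
qed

lemma eventually_at_right_less_along_ray:
  fixes a :: "'a::real_inner"
  assumes "a \<bullet> c < b"
  shows "eventually (\<lambda>e::real. a \<bullet> (c + e *\<^sub>R d) < b) (at_right 0)"
proof -
  have "((\<lambda>e::real. a \<bullet> (c + e *\<^sub>R d)) \<longlongrightarrow> a \<bullet> (c + 0 *\<^sub>R d)) (at_right 0)"
    by (intro tendsto_intros)
  then show ?thesis
    using assms by (auto dest: order_tendstoD(2))
qed

text \<open>A short step from \<open>c\<close> towards \<open>v\<close> stays beneath every facet:
  at facets through \<open>c\<close> because \<open>v\<close> is beneath them, at the others by
  continuity. It thus ends in the interior, where \<open>a\<close> is strictly below
  \<open>b\<close>, and \<open>a \<bullet> c = b\<close> passes this on to \<open>v\<close>.\<close>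

lemma supporting_less_if_beneath:
  assumes Q: "polytope Q" "affine hull Q = UNIV" and c: "c \<in> Q"
    and ben: "\<And>G. G facet_of Q \<Longrightarrow> c \<in> G \<Longrightarrow> beneath Q G v"
    and ab: "Q \<subseteq> {x. a \<bullet> x \<le> b}" "a \<bullet> c = b" "a \<noteq> 0"
  shows "a \<bullet> v < b"
proof -
  have "eventually (\<lambda>e::real. beneath Q G (c + e *\<^sub>R (v - c))) (at_right 0)"
    if G: "G facet_of Q" for G
  proof (cases "c \<in> G")
    case True
    then obtain a' b' where *: "Q \<subseteq> {x. a' \<bullet> x \<le> b'}" "G = Q \<inter> {x. a' \<bullet> x = b'}" "a' \<bullet> v < b'"
      using ben[OF G] unfolding beneath_def by blast
    have "beneath Q G (c + e *\<^sub>R (v - c))" if "e > 0" for e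
      unfolding beneath_def using * True that
      by (intro exI[of _ a'] exI[of _ b']) (auto simp: inner_right_distrib inner_diff_right mult_less_0_iff)
    then show ?thesis
      unfolding eventually_at_right_field by (intro exI[of _ 1]) auto
  next
    case False
    obtain a' b' where *: "Q \<subseteq> {x. a' \<bullet> x \<le> b'}" "G = Q \<inter> {x. a' \<bullet> x = b'}"
      using facet_supporting_hyperplane[OF Q(1) G] .
    then have "a' \<bullet> c < b'"
      using c False by force
    from eventually_at_right_less_along_ray[OF this, of "v - c"] show ?thesis
      by eventually_elim (use * in \<open>auto simp: beneath_def\<close>)
  qed
  \<comment> \<open>There are finitely many facets, so one step length serves them all.\<close>
  then have "eventually (\<lambda>e::real. \<forall>G\<in>{G. G facet_of Q}. beneath Q G (c + e *\<^sub>R (v - c))) (at_right 0)"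
    using finite_polytope_facets[OF Q(1)] by (intro eventually_ball_finite) auto
  then have "eventually (\<lambda>e::real. e > 0 \<and> (\<forall>G\<in>{G. G facet_of Q}. beneath Q G (c + e *\<^sub>R (v - c)))) (at_right 0)"
    using eventually_at_right_less[of "0::real"] eventually_conj by blast
  then obtain e :: real where e: "e > 0" "\<And>G. G facet_of Q \<Longrightarrow> beneath Q G (c + e *\<^sub>R (v - c))"
    using eventually_happens trivial_limit_at_right_real by blast
  have "a \<bullet> (c + e *\<^sub>R (v - c)) < b"
    using beneath_all_facets_imp_interior[OF Q e(2)] ab supporting_hyperplane_interior_less by blast
  then show ?thesis
    using e(1) ab(2) by (auto simp: inner_right_distrib inner_diff_right mult_less_0_iff)
qed

text \<open>The point is found by leaving the polytope at a relative interior point \<open>c\<close> of \<open>F\<close>, on a short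
  step directly away from an interior point \<open>p\<close>.\<close>

lemma stellar_point_exists:
  assumes Q: "polytope Q" "affine hull Q = UNIV"
    and F: "F face_of Q" "F \<noteq> {}"
  shows "\<exists>v. stellar_point Q F v"
proof -
  have "convex F" using F face_of_imp_convex by blast
  then obtain c where c: "c \<in> rel_interior F"
    using F(2) rel_interior_eq_empty by blast
  then have cF: "c \<in> F" using rel_interior_subset by blast
  have FQ: "F \<subseteq> Q" using F face_of_imp_subset by blast
  have "rel_interior Q \<noteq> {}"
    using Q by (metis affine_hull_empty empty_not_UNIV polytope_imp_convex rel_interior_eq_empty)
  then obtain p where p: "p \<in> interior Q"
    using Q by (auto simp: rel_interior_interior)
  have "eventually (\<lambda>e::real. if F \<subseteq> G then beyond Q G (c + e *\<^sub>R (c - p))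
           else beneath Q G (c + e *\<^sub>R (c - p))) (at_right 0)" if G: "G facet_of Q" for G
  proof -
    obtain a b where ab: "Q \<subseteq> {x. a \<bullet> x \<le> b}" "G = Q \<inter> {x. a \<bullet> x = b}"
      using facet_supporting_hyperplane[OF Q(1) G] .
    show ?thesis
    proof (cases "F \<subseteq> G")
      case True
      have "G \<noteq> Q" using G by auto
      \<comment> \<open>For \<open>a = 0\<close> the point \<open>c\<close> would force
        \<open>b = 0\<close> and hence \<open>G = Q\<close>.\<close>
      then have "a \<noteq> 0" using ab cF FQ True by auto
      then have "a \<bullet> p < b" using ab p supporting_hyperplane_interior_less by blast
      moreover have "a \<bullet> c = b" using ab True cF by auto
      ultimately have "beyond Q G (c + e *\<^sub>R (c - p))" if "e > 0" for e
        unfolding beyond_def using ab that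
        by (intro exI[of _ a] exI[of _ b]) (auto simp: inner_right_distrib inner_diff_right)
      then show ?thesis
        unfolding eventually_at_right_field using True by (intro exI[of _ 1]) auto
    next
      case False
      \<comment> \<open>A face containing a relative interior point of \<open>F\<close> contains all
        of \<open>F\<close>.\<close>
      then have "c \<notin> G"
        using subset_of_face_of[OF facet_of_imp_face_of[OF G] FQ] c by blast
      then have "a \<bullet> c < b" using ab cF FQ by force
      from eventually_at_right_less_along_ray[OF this, of "c - p"] show ?thesis
        by eventually_elim (use False ab in \<open>auto simp: beneath_def\<close>)
    qed
  qed
  then have "eventually (\<lambda>e::real. \<forall>G\<in>{G. G facet_of Q}. if F \<subseteq> G
      then beyond Q G (c + e *\<^sub>R (c - p)) else beneath Q G (c + e *\<^sub>R (c - p))) (at_right 0)"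
    using finite_polytope_facets[OF Q(1)] by (intro eventually_ball_finite) auto
  then obtain e :: real where "\<forall>G\<in>{G. G facet_of Q}. if F \<subseteq> G
      then beyond Q G (c + e *\<^sub>R (c - p)) else beneath Q G (c + e *\<^sub>R (c - p))"
    using eventually_happens trivial_limit_at_right_real by blast
  then show ?thesis
    unfolding stellar_point_def using Q(2) by blast
qed

section \<open>Stellar subdivision\<close>

text \<open>The exposed set is unchanged, so \<open>s\<close> is a free parameter for adjusting the
  value at a further point.\<close>

lemma exposing_functional_add:
  assumes "\<forall>w\<in>V. a \<bullet> w \<le> b" "\<forall>w\<in>V. a' \<bullet> w \<le> b'" "0 \<le> (s::real)"
    and "\<sigma> = {w \<in> V. a \<bullet> w = b}" "\<sigma> \<subseteq> {w. a' \<bullet> w = b'}"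
  shows "\<forall>w\<in>V. (a + s *\<^sub>R a') \<bullet> w \<le> b + s * b'"
    "\<sigma> = {w \<in> V. (a + s *\<^sub>R a') \<bullet> w = b + s * b'}"
proof -
  have s: "s * (a' \<bullet> w) \<le> s * b'" if "w \<in> V" for w
    using assms(2,3) that by (simp add: mult_left_mono)
  show "\<forall>w\<in>V. (a + s *\<^sub>R a') \<bullet> w \<le> b + s * b'"
    using s assms(1) by (auto simp: inner_add_left intro: add_mono)
  show "\<sigma> = {w \<in> V. (a + s *\<^sub>R a') \<bullet> w = b + s * b'}"
  proof (intro equalityI subsetI)
    fix w assume "w \<in> \<sigma>"
    then show "w \<in> {w \<in> V. (a + s *\<^sub>R a') \<bullet> w = b + s * b'}"
      using assms(4,5) by (auto simp: inner_add_left)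
  next
    fix w assume w: "w \<in> {w \<in> V. (a + s *\<^sub>R a') \<bullet> w = b + s * b'}"
    then have "a \<bullet> w + s * (a' \<bullet> w) = b + s * b'" "a \<bullet> w \<le> b"
      using assms(1) by (auto simp: inner_add_left)
    then have "a \<bullet> w = b" using s[of w] w by simp
    then show "w \<in> \<sigma>" using w assms(4) by simp
  qed
qed

text \<open>The assumption \<open>card_S\<close> keeps all old vertices: no single vertex contains
  \<open>S\<close>, so none is removed.\<close>

locale stellar =
  fixes Q S :: "'a::euclidean_space set" and v :: 'a
  assumes simplicial: "simplicial_polytope Q" and full: "affine hull Q = UNIV"
    and S: "S \<in> snd (boundary_complex Q)" and card_S: "card S \<ge> 2"
    and v: "stellar_point Q (convex hull S) v"
begin

abbreviation "V \<equiv> vertices_of Q"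
abbreviation "K \<equiv> snd (boundary_complex Q)"

lemma polytope_Q: "polytope Q" "Q = convex hull V" "finite V"
  using simplicial polytope_eq_convex_hull_vertices finite_vertices_of
  by (auto simp: simplicial_polytope_iff)

lemma K_iff: "\<sigma> \<in> K \<longleftrightarrow> exposed_subset V \<sigma>"
  using boundary_complex_iff_exposed polytope_Q(1) .

lemma functional_le_on_Q: "\<forall>w\<in>V. a \<bullet> w \<le> b \<Longrightarrow> Q \<subseteq> {x. a \<bullet> x \<le> b}"
  by (subst polytope_Q(2), rule hull_minimal) (auto simp: convex_halfspace_le)

lemma exposed_subset_nontrivial:
  assumes "\<sigma> \<subset> V" "\<sigma> \<noteq> {}" "\<sigma> = {w \<in> V. a \<bullet> w = b}"
  shows "a \<noteq> 0"
proof
  assume a: "a = 0"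
  obtain w where "w \<in> \<sigma>" using assms(2) by blast
  then have "w \<in> {w \<in> V. a \<bullet> w = b}" by (simp only: assms(3)[symmetric])
  then have "b = 0" using a by simp
  then have "{w \<in> V. a \<bullet> w = b} = V" using a by simp
  then show False using assms(1,3) by simp
qed

lemma S_nonempty: "S \<noteq> {}"
  using card_S by auto

lemma not_subset_singleton: "\<not> S \<subseteq> {w}"
  using card_S card_mono[of "{w}" S] by auto

lemma facet_in_K:
  assumes "G facet_of Q"
  shows "V \<inter> G \<in> K"
proof -
  have "G face_of Q" "G \<noteq> Q" using assms by (auto simp: facet_of_imp_face_of)
  then show ?thesis
    unfolding boundary_complex_def using vertices_of_face by fastforce
qed

lemma beyond_facet: "G facet_of Q \<Longrightarrow> convex hull S \<subseteq> G \<Longrightarrow> beyond Q G v"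
  and beneath_facet: "G facet_of Q \<Longrightarrow> \<not> convex hull S \<subseteq> G \<Longrightarrow> beneath Q G v"
  using v unfolding stellar_point_def by presburger+

text \<open>Extends the position of \<open>v\<close> from facets to every supporting hyperplane of a
  face containing \<open>S\<close>. The facets through a relative interior point of
  \<open>convex hull S\<close> all contain \<open>S\<close>.\<close>

lemma functional_pos:
  assumes "\<sigma> \<subset> V" "\<forall>w\<in>V. a \<bullet> w \<le> b" "\<sigma> = {w \<in> V. a \<bullet> w = b}" "S \<subseteq> \<sigma>"
  shows "b < a \<bullet> v"
proof -
  have "a \<noteq> 0"
    using assms S_nonempty by (intro exposed_subset_nontrivial[of \<sigma>]) auto
  have SQ: "convex hull S \<subseteq> Q"
    using boundary_complex_face(1)[OF polytope_Q(1) S] face_of_imp_subset by blast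
  obtain c where c: "c \<in> rel_interior (convex hull S)"
    using S_nonempty by (metis convex_convex_hull convex_hull_eq_empty rel_interior_eq_empty ex_in_conv)
  then have cS: "c \<in> convex hull S" using rel_interior_subset by blast
  have "convex hull S \<subseteq> {x. a \<bullet> x = b}"
    using assms(3,4) by (intro hull_minimal) (auto simp: convex_hyperplane)
  then have ac: "a \<bullet> c = b" using cS by auto
  \<comment> \<open>\<open>v\<close> is beyond all facets through \<open>c\<close>, so its reflection through \<open>c\<close> is beneath them.\<close>
  have "beneath Q G (2 *\<^sub>R c - v)" if G: "G facet_of Q" "c \<in> G" for G
  proof -
    have "convex hull S \<subseteq> G"
      using subset_of_face_of[OF facet_of_imp_face_of[OF G(1)] SQ] c G(2) by blast
    then obtain a' b' where "Q \<subseteq> {x. a' \<bullet> x \<le> b'}" "G = Q \<inter> {x. a' \<bullet> x = b'}" "a' \<bullet> v > b'"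
      using beyond_facet[OF G(1)] unfolding beyond_def by blast
    then show ?thesis
      unfolding beneath_def using G(2)
      by (intro exI[of _ a'] exI[of _ b']) (auto simp: inner_diff_right)
  qed
  then have "a \<bullet> (2 *\<^sub>R c - v) < b"
    using cS SQ functional_le_on_Q[OF assms(2)] ac \<open>a \<noteq> 0\<close>
    by (intro supporting_less_if_beneath[OF polytope_Q(1) full]) auto
  then show ?thesis
    using ac by (simp add: inner_diff_right)
qed

text \<open>A nonempty proper face is the intersection of the facets containing it. If it misses
  part of \<open>S\<close>, so does one of these facets, and \<open>v\<close> is beneath that
  one.\<close>

lemma functional_neg:
  assumes "\<tau> \<in> K" "\<not> S \<subseteq> \<tau>"
  obtains a b where "\<forall>w\<in>V. a \<bullet> w \<le> b" "\<tau> \<subseteq> {w. a \<bullet> w = b}" "a \<bullet> v < b"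
proof -
  have main: "\<exists>G. G facet_of Q \<and> \<tau> \<subseteq> G \<and> \<not> S \<subseteq> G"
    if "\<tau> \<in> K" "\<not> S \<subseteq> \<tau>" "\<tau> \<noteq> {}" for \<tau>
  proof (rule ccontr)
    assume none: "\<not> (\<exists>G. G facet_of Q \<and> \<tau> \<subseteq> G \<and> \<not> S \<subseteq> G)"
    note f = boundary_complex_face[OF polytope_Q(1) that(1)]
    have "convex hull \<tau> = \<Inter>{F. F facet_of Q \<and> convex hull \<tau> \<subseteq> F}"
      using f that(3) polytope_Q(1) by (intro face_of_polyhedron) (auto simp: polytope_imp_polyhedron)
    then have "S \<subseteq> convex hull \<tau>"
      using none hull_subset[of \<tau> convex] by blast
    moreover have "V \<inter> convex hull \<tau> = \<tau>"
    proof -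
      from that(1) obtain a b where ab: "\<tau> = {w \<in> V. a \<bullet> w = b}"
        unfolding K_iff exposed_subset_def by (elim conjE exE)
      have "convex hull \<tau> \<subseteq> {x. a \<bullet> x = b}"
        using ab by (intro hull_minimal) (auto simp: convex_hyperplane)
      then show ?thesis using ab hull_subset[of \<tau> convex] by blast
    qed
    moreover have "S \<subseteq> V" using boundary_complex_face(3)[OF polytope_Q(1) S] by blast
    ultimately show False using that(2) by blast
  qed
  \<comment> \<open>The empty face is not an intersection of facets; a facet missing some vertex of \<open>S\<close> serves instead.\<close>
  obtain w where w: "w \<in> S" using S_nonempty by blast
  have "{w} \<in> K" using boundary_complex_subset[OF simplicial S] w by auto
  from main[OF this] not_subset_singleton
  obtain G\<^sub>0 where "G\<^sub>0 facet_of Q" "\<not> S \<subseteq> G\<^sub>0" by blast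
  then obtain G where G: "G facet_of Q" "\<tau> \<subseteq> G" "\<not> S \<subseteq> G"
    using main[OF assms] by (cases "\<tau> = {}") auto
  then have "\<not> convex hull S \<subseteq> G" using hull_subset[of S convex] by blast
  then obtain a b where "Q \<subseteq> {x. a \<bullet> x \<le> b}" "G = Q \<inter> {x. a \<bullet> x = b}" "a \<bullet> v < b"
    using beneath_facet[OF G(1)] unfolding beneath_def by blast
  then show ?thesis
    using that[of a b] G(2) vertices_of_subset[of Q] by blast
qed

text \<open>For nonempty \<open>\<tau>\<close>, take \<open>c\<close> in the relative interior of
  its hull. If \<open>v\<close> were beneath all facets through \<open>c\<close>, it would satisfy
  \<open>a \<bullet> v < b\<close>. So some facet through \<open>c\<close> contains
  \<open>S\<close>, and by the choice of \<open>c\<close> also \<open>\<tau>\<close>.\<close>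

lemma functional_zero:
  assumes "\<tau> \<subset> V" "\<forall>w\<in>V. a \<bullet> w \<le> b" "\<tau> = {w \<in> V. a \<bullet> w = b}" "a \<bullet> v = b"
  shows "\<tau> \<union> S \<in> K"
proof (cases "\<tau> = {}")
  case True
  then show ?thesis using S by simp
next
  case False
  then have "a \<noteq> 0" using exposed_subset_nontrivial assms(1,3) by blast
  have "\<tau> \<in> K" unfolding K_iff exposed_subset_def using assms(1-3) by blast
  then have TQ: "convex hull \<tau> \<subseteq> Q"
    using boundary_complex_face(1)[OF polytope_Q(1)] face_of_imp_subset by blast
  obtain c where c: "c \<in> rel_interior (convex hull \<tau>)"
    using False by (metis convex_convex_hull convex_hull_eq_empty rel_interior_eq_empty ex_in_conv)
  then have cT: "c \<in> convex hull \<tau>" using rel_interior_subset by blast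
  have "convex hull \<tau> \<subseteq> {x. a \<bullet> x = b}"
    using assms(3) by (intro hull_minimal) (auto simp: convex_hyperplane)
  then have ac: "a \<bullet> c = b" using cT by auto
  obtain G where G: "G facet_of Q" "c \<in> G" "convex hull S \<subseteq> G"
  proof (rule ccontr)
    assume none: "\<not> thesis"
    have "beneath Q G v" if "G facet_of Q" "c \<in> G" for G
      using none that beneath_facet \<open>\<And>G. G facet_of Q \<Longrightarrow> c \<in> G \<Longrightarrow> convex hull S \<subseteq> G \<Longrightarrow> thesis\<close>
      by blast
    then have "a \<bullet> v < b"
      using cT TQ functional_le_on_Q[OF assms(2)] ac \<open>a \<noteq> 0\<close>
      by (intro supporting_less_if_beneath[OF polytope_Q(1) full]) auto
    then show False using assms(4) by simp
  qed
  have "convex hull \<tau> \<subseteq> G"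
    using subset_of_face_of[OF facet_of_imp_face_of[OF G(1)] TQ] c G(2) by blast
  then have "\<tau> \<union> S \<subseteq> V \<inter> G"
    using G(3) hull_subset[of S convex] hull_subset[of \<tau> convex] assms(1)
      boundary_complex_face(3)[OF polytope_Q(1) S] by blast
  then show ?thesis
    using boundary_complex_subset[OF simplicial facet_in_K[OF G(1)]] by blast
qed

lemma v_notin: "v \<notin> V"
proof
  assume "v \<in> V"
  obtain a b where ab: "S \<subset> V" "\<forall>w\<in>V. a \<bullet> w \<le> b" "S = {w \<in> V. a \<bullet> w = b}"
    using S unfolding K_iff exposed_subset_def by blast
  then show False
    using functional_pos[OF ab] \<open>v \<in> V\<close> by force
qed

lemma exposed_old:
  assumes "\<sigma> \<in> K" "\<not> S \<subseteq> \<sigma>"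
  shows "exposed_subset (insert v V) \<sigma>"
proof -
  obtain a b where ab: "\<sigma> \<subset> V" "\<forall>w\<in>V. a \<bullet> w \<le> b" "\<sigma> = {w \<in> V. a \<bullet> w = b}"
    using assms(1) unfolding K_iff exposed_subset_def by blast
  obtain a' b' where ab': "\<forall>w\<in>V. a' \<bullet> w \<le> b'" "\<sigma> \<subseteq> {w. a' \<bullet> w = b'}" "a' \<bullet> v < b'"
    using functional_neg[OF assms] .
  \<comment> \<open>Large enough for the negative contribution of \<open>a'\<close> at
    \<open>v\<close> to outweigh any excess of \<open>a\<close>.\<close>
  define s where "s = (\<bar>a \<bullet> v - b\<bar> + 1) / (b' - a' \<bullet> v)"
  have s: "s \<ge> 0" unfolding s_def using ab'(3) by simp
  have "s * (b' - a' \<bullet> v) = \<bar>a \<bullet> v - b\<bar> + 1"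
    unfolding s_def using ab'(3) by simp
  then have less: "(a + s *\<^sub>R a') \<bullet> v < b + s * b'"
    by (simp add: inner_add_left algebra_simps)
  note comb = exposing_functional_add[OF ab(2) ab'(1) s ab(3) ab'(2)]
  show ?thesis
    unfolding exposed_subset_def
  proof (intro conjI exI[of _ "a + s *\<^sub>R a'"] exI[of _ "b + s * b'"])
    show "\<sigma> \<subset> insert v V"
      using ab(1) by auto
    show "\<forall>w\<in>insert v V. (a + s *\<^sub>R a') \<bullet> w \<le> b + s * b'"
      using less comb(1) by simp
    show "\<sigma> = {w \<in> insert v V. (a + s *\<^sub>R a') \<bullet> w = b + s * b'}"
      using less by (subst comb(2)) auto
  qed
qed

lemma exposed_new:
  assumes "\<tau> \<in> K" "\<not> S \<subseteq> \<tau>" "\<tau> \<union> S \<in> K"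
  shows "exposed_subset (insert v V) (insert v \<tau>)"
proof -
  obtain a b where ab: "\<tau> \<subset> V" "\<forall>w\<in>V. a \<bullet> w \<le> b" "\<tau> = {w \<in> V. a \<bullet> w = b}"
    using assms(1) unfolding K_iff exposed_subset_def by blast
  \<comment> \<open>The second functional has the opposite sign at \<open>v\<close>: it comes from a
    facet avoiding part of \<open>S\<close>, or exposes \<open>\<tau> \<union> S\<close>.\<close>
  obtain a' b' where ab': "\<forall>w\<in>V. a' \<bullet> w \<le> b'" "\<tau> \<subseteq> {w. a' \<bullet> w = b'}"
    and sgn: "(b \<le> a \<bullet> v \<and> a' \<bullet> v < b') \<or> (a \<bullet> v \<le> b \<and> b' < a' \<bullet> v)"
  proof (cases "b \<le> a \<bullet> v")
    case True
    obtain a' b' where "\<forall>w\<in>V. a' \<bullet> w \<le> b'" "\<tau> \<subseteq> {w. a' \<bullet> w = b'}" "a' \<bullet> v < b'"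
      using functional_neg[OF assms(1,2)] .
    then show ?thesis using that[of a' b'] True by simp
  next
    case False
    obtain a' b' where *: "\<tau> \<union> S \<subset> V" "\<forall>w\<in>V. a' \<bullet> w \<le> b'" "\<tau> \<union> S = {w \<in> V. a' \<bullet> w = b'}"
      using assms(3) unfolding K_iff exposed_subset_def by blast
    have "b' < a' \<bullet> v" by (rule functional_pos[OF *]) simp
    moreover have "\<tau> \<subseteq> {w. a' \<bullet> w = b'}" using *(3) by blast
    ultimately show ?thesis using that[of a' b'] *(2) False by simp
  qed
  \<comment> \<open>The solution of the equation that makes the sum tight at \<open>v\<close>;
    \<open>sgn\<close> ensures that it is nonnegative.\<close>
  define s where "s = (a \<bullet> v - b) / (b' - a' \<bullet> v)"
  have s: "s \<ge> 0" unfolding s_def using sgn by (auto simp: divide_nonneg_pos divide_nonpos_neg)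
  have "s * (b' - a' \<bullet> v) = a \<bullet> v - b"
    unfolding s_def using sgn by auto
  then have zero: "(a + s *\<^sub>R a') \<bullet> v = b + s * b'"
    by (simp add: inner_add_left algebra_simps)
  note comb = exposing_functional_add[OF ab(2) ab'(1) s ab(3) ab'(2)]
  show ?thesis
    unfolding exposed_subset_def
  proof (intro conjI exI[of _ "a + s *\<^sub>R a'"] exI[of _ "b + s * b'"])
    show "insert v \<tau> \<subset> insert v V"
      using ab(1) v_notin by auto
    show "\<forall>w\<in>insert v V. (a + s *\<^sub>R a') \<bullet> w \<le> b + s * b'"
      using zero comb(1) by simp
    show "insert v \<tau> = {w \<in> insert v V. (a + s *\<^sub>R a') \<bullet> w = b + s * b'}"
      using zero by (subst comb(2)) auto
  qed
qed

text \<open>Dropping \<open>v\<close> from an exposed set leaves an old face. It cannot contain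
  \<open>S\<close>, as its functional would then exceed \<open>b\<close> at \<open>v\<close>; if the
  functional is tight at \<open>v\<close>, the old face joined with \<open>S\<close> is a
  face.\<close>

lemma exposed_iff:
  "exposed_subset (insert v V) \<sigma> \<longleftrightarrow>
     \<sigma> \<in> {\<sigma> \<in> K. \<not> S \<subseteq> \<sigma>} \<union> {insert v \<tau> | \<tau>. \<tau> \<in> K \<and> \<not> S \<subseteq> \<tau> \<and> \<tau> \<union> S \<in> K}"
proof
  assume "exposed_subset (insert v V) \<sigma>"
  then obtain a b where ab: "\<sigma> \<subset> insert v V" "\<forall>w\<in>insert v V. a \<bullet> w \<le> b"
    "\<sigma> = {w \<in> insert v V. a \<bullet> w = b}"
    unfolding exposed_subset_def by blast
  show "\<sigma> \<in> {\<sigma> \<in> K. \<not> S \<subseteq> \<sigma>} \<union> {insert v \<tau> | \<tau>. \<tau> \<in> K \<and> \<not> S \<subseteq> \<tau> \<and> \<tau> \<union> S \<in> K}"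
  proof (cases "v \<in> \<sigma>")
    case False
    then have less: "a \<bullet> v < b" and eq: "\<sigma> = {w \<in> V. a \<bullet> w = b}"
      using ab by auto
    \<comment> \<open>A functional constant on \<open>V\<close> is constant on the whole space,
      hence equal to \<open>b\<close> at \<open>v\<close> as well.\<close>
    have "\<sigma> \<noteq> V"
    proof
      assume "\<sigma> = V"
      then have "V \<subseteq> {x. a \<bullet> x = b}" using eq by blast
      then have "affine hull V \<subseteq> {x. a \<bullet> x = b}"
        by (intro hull_minimal) (auto simp: affine_hyperplane)
      moreover have "affine hull V = UNIV"
        using full polytope_Q(2) by (metis affine_hull_convex_hull)
      ultimately show False using less by auto
    qed
    then have \<sigma>: "\<sigma> \<subset> V" using eq by blast
    then have "\<sigma> \<in> K" unfolding K_iff exposed_subset_def using eq ab(2) by blast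
    moreover have "\<not> S \<subseteq> \<sigma>"
      using functional_pos[OF \<sigma> _ eq] ab(2) less by force
    ultimately show ?thesis by blast
  next
    case True
    define \<tau> where "\<tau> = \<sigma> - {v}"
    have eq: "\<tau> = {w \<in> V. a \<bullet> w = b}" and zero: "a \<bullet> v = b" and ins: "\<sigma> = insert v \<tau>"
      using ab(3) True v_notin unfolding \<tau>_def by auto
    have \<tau>: "\<tau> \<subset> V" using ab(1) eq ins by blast
    then have "\<tau> \<in> K" unfolding K_iff exposed_subset_def using eq ab(2) by blast
    moreover have "\<not> S \<subseteq> \<tau>"
      using functional_pos[OF \<tau> _ eq] ab(2) zero by force
    moreover have "\<tau> \<union> S \<in> K"
      using functional_zero[OF \<tau> _ eq zero] ab(2) by blast
    ultimately show ?thesis using ins by blast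
  qed
qed (use exposed_old exposed_new in blast)

section \<open>Vertices and boundary complex of the subdivided polytope\<close>

lemma singleton_in_K: "w \<in> V \<Longrightarrow> {w} \<in> K"
proof -
  assume w: "w \<in> V"
  then have face: "{w} face_of Q" by (simp add: vertices_of_def face_of_singleton)
  have "vertices_of {w} = {w}" using vertices_of_face[OF face] w by auto
  moreover have "{w} \<noteq> Q"
    using boundary_complex_face(3)[OF polytope_Q(1) S] vertices_of_subset[of Q] not_subset_singleton[of w]
    by blast
  ultimately show ?thesis
    unfolding boundary_complex_def using face by force
qed

lemma stellar_subdivision_eq: "stellar_subdivision Q v = convex hull (insert v V)"
  unfolding stellar_subdivision_def
  using hull_Un_left[of convex V "{v}"] polytope_Q(2) by simp

lemma vertices_of_stellar_subdivision: "vertices_of (stellar_subdivision Q v) = insert v V"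
  unfolding stellar_subdivision_eq
proof (rule vertices_of_convex_hull)
  show "finite (insert v V)" using polytope_Q(3) by simp
  fix w assume "w \<in> insert v V"
  \<comment> \<open>The vertex \<open>v\<close> is the new face arising from
    \<open>\<tau> = {}\<close>.\<close>
  moreover have "{} \<in> K" using boundary_complex_subset[OF simplicial S] by blast
  then have "exposed_subset (insert v V) {v}"
    using exposed_new[of "{}"] S S_nonempty by simp
  ultimately show "exposed_subset (insert v V) {w}"
    using exposed_old[OF singleton_in_K] not_subset_singleton by blast
qed

lemma polytope_stellar_subdivision: "polytope (stellar_subdivision Q v)"
  unfolding stellar_subdivision_eq using polytope_Q(3) by (simp add: polytope_convex_hull)

lemma boundary_complex_stellar_subdivision:
  "snd (boundary_complex (stellar_subdivision Q v)) =
     {\<sigma> \<in> K. \<not> S \<subseteq> \<sigma>} \<union> {insert v \<tau> | \<tau>. \<tau> \<in> K \<and> \<not> S \<subseteq> \<tau> \<and> \<tau> \<union> S \<in> K}"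
  by (rule set_eqI)
    (simp only: boundary_complex_iff_exposed[OF polytope_stellar_subdivision]
      vertices_of_stellar_subdivision exposed_iff)

lemma affine_hull_stellar_subdivision: "affine hull stellar_subdivision Q v = UNIV"
proof -
  have "Q \<subseteq> stellar_subdivision Q v"
    unfolding stellar_subdivision_def using hull_subset[of "Q \<union> {v}" convex] by simp
  then have "affine hull Q \<subseteq> affine hull stellar_subdivision Q v" by (rule hull_mono)
  then show ?thesis using full by (simp add: top.extremum_unique)
qed

text \<open>A functional exposing \<open>\<tau> \<union> S\<close> is constant on the affine hull of
  \<open>\<tau>\<close> and larger at \<open>v\<close>, so adding \<open>v\<close> preserves affine
  independence.\<close>

lemma simplicial_stellar_subdivision: "simplicial_polytope (stellar_subdivision Q v)"
proof -
  have ind: "\<not> affine_dependent \<sigma>" if "\<sigma> \<in> K" for \<sigma>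
    using simplicial that by (simp add: simplicial_polytope_iff)
  have "\<not> affine_dependent (insert v \<tau>)" if \<tau>: "\<tau> \<in> K" "\<tau> \<union> S \<in> K" for \<tau>
  proof (rule affine_independent_insert[OF ind[OF \<tau>(1)]])
    obtain a b where ab: "\<tau> \<union> S \<subset> V" "\<forall>w\<in>V. a \<bullet> w \<le> b" "\<tau> \<union> S = {w \<in> V. a \<bullet> w = b}"
      using \<tau>(2) unfolding K_iff exposed_subset_def by blast
    have "affine hull \<tau> \<subseteq> {x. a \<bullet> x = b}"
      using ab(3) by (intro hull_minimal) (auto simp: affine_hyperplane)
    then show "v \<notin> affine hull \<tau>"
      using functional_pos[OF ab] by auto
  qed
  then show ?thesis
    unfolding simplicial_polytope_iff boundary_complex_stellar_subdivision
    using polytope_stellar_subdivision ind by blast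
qed

end

section \<open>The cross polytope\<close>

abbreviation cross_vertices :: "(real ^ 'n) set" where
  "cross_vertices \<equiv> range (\<lambda>i. axis i 1) \<union> range (\<lambda>i. - axis i 1)"

lemma axis_neq_uminus_axis: "axis i (1::real) \<noteq> - axis j 1"
proof
  assume "axis i (1::real) = - axis j 1"
  then have "axis i (1::real) $ i = (- axis j 1) $ i" by simp
  then show False by (simp add: axis_def split: if_splits)
qed

lemma axis_one_eq_iff: "axis i (1::real) = axis j 1 \<longleftrightarrow> i = j"
  by (simp add: axis_eq_axis)

text \<open>An antipodal pair forces \<open>b = 0\<close>. Then \<open>a\<close> vanishes on all
  axes, and every vertex would be exposed.\<close>

lemma exposed_subset_cross_iff:
  fixes \<sigma> :: "(real ^ 'n) set"
  shows "exposed_subset cross_vertices \<sigma> \<longleftrightarrow>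
     \<sigma> \<subseteq> cross_vertices \<and> (\<forall>i. \<not> (axis i 1 \<in> \<sigma> \<and> - axis i 1 \<in> \<sigma>))"
proof
  assume "exposed_subset cross_vertices \<sigma>"
  then obtain a b where ab: "\<sigma> \<subset> cross_vertices" "\<forall>w\<in>cross_vertices. a \<bullet> w \<le> b"
    "\<sigma> = {w \<in> cross_vertices. a \<bullet> w = b}"
    unfolding exposed_subset_def by blast
  have False if i: "axis i 1 \<in> \<sigma>" "- axis i 1 \<in> \<sigma>" for i
  proof -
    have "a \<bullet> axis i 1 = b" "a \<bullet> (- axis i 1) = b" using i ab(3) by blast+
    then have b: "b = 0" by simp
    have "a \<bullet> axis j 1 = 0" for j
    proof -
      have "a \<bullet> axis j 1 \<le> b" "a \<bullet> (- axis j 1) \<le> b" using ab(2) by blast+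
      then show ?thesis using b by simp
    qed
    then have "\<sigma> = cross_vertices" using ab(3) b by auto
    then show False using ab(1) by blast
  qed
  then show "\<sigma> \<subseteq> cross_vertices \<and> (\<forall>i. \<not> (axis i 1 \<in> \<sigma> \<and> - axis i 1 \<in> \<sigma>))"
    using ab(1) by blast
next
  assume \<sigma>: "\<sigma> \<subseteq> cross_vertices \<and> (\<forall>i. \<not> (axis i 1 \<in> \<sigma> \<and> - axis i 1 \<in> \<sigma>))"
  \<comment> \<open>The sign vector of \<open>\<sigma>\<close>, with 0 at the axes that
    \<open>\<sigma>\<close> misses.\<close>
  define a :: "real ^ 'n" where
    "a = (\<chi> i. if axis i 1 \<in> \<sigma> then 1 else if - axis i 1 \<in> \<sigma> then - 1 else 0)"
  have a: "a \<bullet> axis i 1 = (if axis i 1 \<in> \<sigma> then 1 else if - axis i 1 \<in> \<sigma> then - 1 else 0)" for i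
    by (simp add: inner_axis a_def)
  have "\<sigma> \<noteq> cross_vertices" using \<sigma> by auto
  moreover have "\<forall>w\<in>cross_vertices. a \<bullet> w \<le> 1" by (auto simp: a)
  moreover have "a \<bullet> w = 1 \<longleftrightarrow> w \<in> \<sigma>" if "w \<in> cross_vertices" for w
    using that \<sigma> by (auto simp: a split: if_splits)
  then have "\<sigma> = {w \<in> cross_vertices. a \<bullet> w = 1}"
    using \<sigma> by blast
  ultimately show "exposed_subset cross_vertices \<sigma>"
    unfolding exposed_subset_def using \<sigma> by blast
qed

lemma vertices_of_cross_polytope:
  "vertices_of cross_polytope = (cross_vertices :: (real ^ 'n) set)"
  unfolding cross_polytope_def
proof (rule vertices_of_convex_hull)
  fix w :: "real ^ 'n" assume "w \<in> cross_vertices"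
  then show "exposed_subset cross_vertices {w}"
    unfolding exposed_subset_cross_iff by (metis axis_neq_uminus_axis empty_subsetI insert_subset singletonD)
qed simp

lemma polytope_cross_polytope: "polytope cross_polytope"
  unfolding cross_polytope_def by (intro polytope_convex_hull) auto

lemma boundary_complex_cross_polytope:
  "\<sigma> \<in> snd (boundary_complex cross_polytope) \<longleftrightarrow>
     \<sigma> \<subseteq> cross_vertices \<and> (\<forall>i. \<not> (axis i 1 \<in> \<sigma> \<and> - axis i 1 \<in> \<sigma>))"
  unfolding boundary_complex_iff_exposed[OF polytope_cross_polytope] vertices_of_cross_polytope
    exposed_subset_cross_iff ..

text \<open>Without antipodal pairs, distinct vertices of a face are orthogonal and nonzero, hence
  linearly independent.\<close>

lemma simplicial_cross_polytope: "simplicial_polytope cross_polytope"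
  unfolding simplicial_polytope_iff
proof (intro conjI ballI polytope_cross_polytope)
  fix \<sigma> :: "(real ^ 'n) set" assume "\<sigma> \<in> snd (boundary_complex cross_polytope)"
  then have \<sigma>: "\<sigma> \<subseteq> cross_vertices" "\<And>i. \<not> (axis i 1 \<in> \<sigma> \<and> - axis i 1 \<in> \<sigma>)"
    by (auto simp: boundary_complex_cross_polytope)
  have "orthogonal x y" if xy: "x \<in> \<sigma>" "y \<in> \<sigma>" "x \<noteq> y" for x y
  proof -
    obtain i where i: "x = axis i 1 \<or> x = - axis i 1" using \<sigma>(1) xy(1) by blast
    obtain j where j: "y = axis j 1 \<or> y = - axis j 1" using \<sigma>(1) xy(2) by blast
    have "i \<noteq> j" using i j xy \<sigma>(2)[of i] by auto
    then have "axis i (1::real) \<bullet> axis j 1 = 0"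
      by (simp add: inner_axis_axis)
    then show ?thesis using i j by (auto simp: orthogonal_def)
  qed
  then have "pairwise orthogonal \<sigma>" by (simp add: pairwise_def)
  moreover have "0 \<notin> \<sigma>" using \<sigma>(1) by (auto simp: axis_eq_0_iff)
  ultimately have "independent \<sigma>" by (rule pairwise_orthogonal_independent)
  then show "\<not> affine_dependent \<sigma>" using affine_dependent_imp_dependent by blast
qed

text \<open>The origin is the midpoint of two antipodal vertices, so the affine hull is the linear
  span.\<close>

lemma affine_hull_cross_polytope: "affine hull cross_polytope = (UNIV :: (real ^ 'n) set)"
proof -
  fix i :: 'n
  have "midpoint (axis i 1) (- axis i 1) \<in> convex hull (cross_vertices :: (real ^ 'n) set)"
    using convexD_alt[OF convex_convex_hull, of "axis i 1" cross_vertices "- axis i 1" "1/2"]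
      hull_subset[of cross_vertices convex]
    by (auto simp: midpoint_def)
  then have "0 \<in> affine hull (cross_vertices :: (real ^ 'n) set)"
    using convex_hull_subset_affine_hull by (auto simp: midpoint_def)
  then have "affine hull cross_vertices = span (cross_vertices :: (real ^ 'n) set)"
    by (rule affine_hull_span_0)
  moreover have "Basis \<subseteq> (cross_vertices :: (real ^ 'n) set)"
    by (auto simp: Basis_vec_def)
  then have "span Basis \<subseteq> span (cross_vertices :: (real ^ 'n) set)"
    by (rule span_mono)
  ultimately show ?thesis
    unfolding cross_polytope_def by (auto simp: affine_hull_convex_hull)
qed

text \<open>Singletons are always nested or disjoint, and two or more of them never have a singleton
  as union. Only the condition on formal symbols remains.\<close>

lemma extended_nested_collection_singletons:
  "extended_nested_collection UNIV (range (\<lambda>i. {i})) \<sigma> \<longleftrightarrow>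
     \<sigma> \<subseteq> Block ` range (\<lambda>i. {i}) \<union> range Formal \<and> (\<forall>i. \<not> (Block {i} \<in> \<sigma> \<and> Formal i \<in> \<sigma>))"
proof
  assume "extended_nested_collection UNIV (range (\<lambda>i. {i})) \<sigma>"
  from extended_nested_collectionD[OF this]
  show "\<sigma> \<subseteq> Block ` range (\<lambda>i. {i}) \<union> range Formal \<and> (\<forall>i. \<not> (Block {i} \<in> \<sigma> \<and> Formal i \<in> \<sigma>))"
    by blast
next
  assume \<sigma>: "\<sigma> \<subseteq> Block ` range (\<lambda>i. {i}) \<union> range Formal \<and> (\<forall>i. \<not> (Block {i} \<in> \<sigma> \<and> Formal i \<in> \<sigma>))"
  then have block: "\<exists>i. J = {i}" if "Block J \<in> \<sigma>" for J using that by blast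
  show "extended_nested_collection UNIV (range (\<lambda>i. {i})) \<sigma>"
  proof (rule extended_nested_collectionI)
    show "J \<subseteq> L \<or> L \<subseteq> J \<or> J \<inter> L = {}" if "Block J \<in> \<sigma>" "Block L \<in> \<sigma>" for J L
      using block[OF that(1)] by auto
    show "i \<notin> J" if "Formal i \<in> \<sigma>" "Block J \<in> \<sigma>" for i J
      using block[OF that(2)] that \<sigma> by auto
    show "\<Union>C \<notin> range (\<lambda>i. {i})" if C: "Block ` C \<subseteq> \<sigma>" "card C \<ge> 2" for C
    proof
      assume "\<Union>C \<in> range (\<lambda>i. {i})"
      then obtain j where j: "\<Union>C = {j}" by blast
      have "{} \<notin> C" using block C(1) by blast
      then show False using C(2) card_le_1_if_Union_singleton[OF _ j] by simp
    qed
  qed (use \<sigma> in simp)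
qed

lemma complex_iso_cross_polytope:
  fixes lab :: "'n label \<Rightarrow> real ^ 'n"
  assumes lab: "\<And>i. lab (Block {i}) = axis i 1" "\<And>i. lab (Formal i) = - axis i 1"
  shows "complex_iso lab (extended_nested_complex UNIV (range (\<lambda>i. {i}))) (boundary_complex cross_polytope)"
proof -
  let ?L = "Block ` range (\<lambda>i. {i}) \<union> range Formal :: 'n label set"
  have inj: "inj_on lab ?L"
    by (auto simp: inj_on_def lab axis_one_eq_iff axis_neq_uminus_axis axis_neq_uminus_axis[symmetric])
  have img: "lab ` ?L = cross_vertices"
    by (auto simp: image_Un image_image lab)
  have "extended_nested_collection UNIV (range (\<lambda>i. {i})) \<sigma> \<longleftrightarrow>
      lab ` \<sigma> \<in> snd (boundary_complex cross_polytope)" if \<sigma>: "\<sigma> \<subseteq> ?L" for \<sigma>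
  proof -
    have "axis i 1 \<in> lab ` \<sigma> \<longleftrightarrow> Block {i} \<in> \<sigma>" for i
      using inj_on_image_mem_iff[OF inj _ \<sigma>, of "Block {i}"] lab by simp
    moreover have "- axis i 1 \<in> lab ` \<sigma> \<longleftrightarrow> Formal i \<in> \<sigma>" for i
      using inj_on_image_mem_iff[OF inj _ \<sigma>, of "Formal i"] lab by simp
    moreover have "lab ` \<sigma> \<subseteq> cross_vertices" using \<sigma> img by blast
    ultimately show ?thesis
      using \<sigma> by (simp add: boundary_complex_cross_polytope extended_nested_collection_singletons)
  qed
  then show ?thesis
    unfolding complex_iso_def extended_nested_complex_def
    using inj img by (auto simp: bij_betw_def boundary_complex_def vertices_of_cross_polytope)
qed

section \<open>Runs of subdivisions\<close>

text \<open>The invariant of a run. Full dimension is carried along because the stellar subdivision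
  argument uses interior points.\<close>

definition nested_stage :: "'n::finite set set \<Rightarrow> (real ^ 'n) set \<Rightarrow> ('n label \<Rightarrow> real ^ 'n) \<Rightarrow> bool" where
  "nested_stage B Q lab \<longleftrightarrow> simplicial_polytope Q \<and> affine hull Q = UNIV \<and>
     complex_iso lab (extended_nested_complex UNIV B) (boundary_complex Q)"

context
  fixes B :: "'n::finite set set" and I Q lab
  assumes ext: "building_set_extension UNIV B I" and stage: "nested_stage B Q lab"
begin

interpretation building_set_extension UNIV B I by (fact ext)

lemma singleton_vertices_eq: "singleton_vertices lab I = lab ` D"
  by (auto simp: singleton_vertices_def image_image)

lemma D_subset_labels: "D \<subseteq> Block ` B \<union> Formal ` UNIV"
  using singletons_nested by (rule extended_nested_collectionD(1))

lemma singleton_vertices_face: "singleton_vertices lab I \<in> snd (boundary_complex Q)"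
  using stage singletons_nested D_subset_labels unfolding singleton_vertices_eq
  by (auto simp: nested_stage_def complex_iso_def extended_nested_complex_def)

lemma card_singleton_vertices: "card (singleton_vertices lab I) \<ge> 2"
proof -
  have "inj_on lab (Block ` B \<union> Formal ` UNIV)"
    using stage by (auto simp: nested_stage_def complex_iso_def extended_nested_complex_def bij_betw_def)
  then have "inj_on lab D" using D_subset_labels by (rule inj_on_subset)
  then have "card (lab ` D) = card I" by (simp add: card_image inj_on_def)
  then show ?thesis using card_I unfolding singleton_vertices_eq by simp
qed

lemma nested_stage_stellar_point_exists:
  "\<exists>v. stellar_point Q (convex hull (singleton_vertices lab I)) v"
proof (rule stellar_point_exists)
  show "polytope Q" "affine hull Q = UNIV"
    using stage by (auto simp: nested_stage_def simplicial_polytope_def)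
  then show "convex hull singleton_vertices lab I face_of Q"
    using boundary_complex_face singleton_vertices_face by blast
  show "convex hull singleton_vertices lab I \<noteq> {}"
    using card_singleton_vertices by auto
qed

text \<open>Geometry and combinatorics meet here: the new boundary complex and the complex of
  \<open>insert I B\<close> are the same stellar subdivision, up to the labelling.\<close>

lemma nested_stage_stellar_subdivision:
  assumes "stellar_point Q (convex hull (singleton_vertices lab I)) v"
  shows "nested_stage (insert I B) (stellar_subdivision Q v) (lab(Block I := v))"
proof -
  interpret s: stellar Q "singleton_vertices lab I" v
    using stage assms singleton_vertices_face card_singleton_vertices
    by unfold_locales (auto simp: nested_stage_def)
  have "complex_iso (lab(Block I := v)) (extended_nested_complex UNIV (insert I B))
      (insert v s.V, snd (boundary_complex (stellar_subdivision Q v)))"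
  proof (rule complex_iso_stellar)
    show "complex_iso lab (extended_nested_complex UNIV B) (s.V, s.K)"
      using stage by (simp add: nested_stage_def boundary_complex_def)
    show "s.K \<subseteq> Pow s.V"
      using boundary_complex_face(3)[OF s.polytope_Q(1)] by blast
  qed (use s.v_notin s.boundary_complex_stellar_subdivision singleton_vertices_eq in auto)
  moreover have "fst (boundary_complex (stellar_subdivision Q v)) = insert v s.V"
    using s.vertices_of_stellar_subdivision by (simp add: boundary_complex_def)
  ultimately show ?thesis
    unfolding nested_stage_def
    using s.simplicial_stellar_subdivision s.affine_hull_stellar_subdivision
    by (metis prod.collapse)
qed

end

section \<open>Initial segments of the list of blocks\<close>

definition blocks :: "'n::finite set list \<Rightarrow> 'n set set" where
  "blocks Is = range (\<lambda>i. {i}) \<union> set Is"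

definition admissible :: "'n::finite set list \<Rightarrow> bool" where
  "admissible Is \<longleftrightarrow> building_set UNIV (blocks Is) \<and> distinct Is \<and>
     (\<forall>I\<in>set Is. \<not> is_singleton I) \<and> sorted_wrt (\<lambda>I J. card I \<ge> card J) Is"

text \<open>Only the union of two earlier blocks could be lost by removing \<open>I\<close>. If such
  a union of non-singletons were \<open>I\<close>, then \<open>J \<subseteq> I\<close> and
  \<open>card I \<le> card J\<close> would give \<open>J = I\<close>, against distinctness.\<close>

lemma admissible_snoc:
  assumes "admissible (Is @ [I])"
  shows "admissible Is" "building_set_extension UNIV (blocks Is) I"
proof -
  have bs: "building_set UNIV (insert I (blocks Is))"
    using assms by (auto simp: admissible_def blocks_def)
  have I: "I \<notin> set Is" "\<not> is_singleton I" and card: "\<And>J. J \<in> set Is \<Longrightarrow> card I \<le> card J"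
    using assms by (auto simp: admissible_def sorted_wrt_append)
  have "J \<union> L \<in> blocks Is" if JL: "J \<in> blocks Is" "L \<in> blocks Is" "J \<inter> L \<noteq> {}" for J L
  proof (cases "is_singleton J \<or> is_singleton L")
    case True
    then have "J \<union> L = J \<or> J \<union> L = L" using JL(3) by (auto simp: is_singleton_def)
    then show ?thesis using JL by auto
  next
    case False
    then have J: "J \<in> set Is" using JL by (auto simp: blocks_def)
    have "J \<union> L \<noteq> I"
    proof
      assume "J \<union> L = I"
      then have "J = I" using card[OF J] by (intro card_seteq) auto
      then show False using I J by simp
    qed
    moreover have "J \<union> L \<in> insert I (blocks Is)"
      using bs JL unfolding building_set_def by simp
    ultimately show ?thesis by simp
  qed
  then have "building_set UNIV (blocks Is)"
    using bs by (auto simp: building_set_def blocks_def)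
  then show "admissible Is"
    using assms by (auto simp: admissible_def sorted_wrt_append)
  show "building_set_extension UNIV (blocks Is) I"
  proof
    show "I \<notin> blocks Is" using I by (auto simp: blocks_def)
    show "is_singleton J" if "J \<in> blocks Is" "card J < card I" for J
      using that card[of J] by (auto simp: blocks_def)
  qed fact+
qed

lemma blocks_snoc: "blocks (Is @ [I]) = insert I (blocks Is)"
  by (auto simp: blocks_def)

lemma admissible_appendD: "admissible (Is @ Js) \<Longrightarrow> admissible Is"
proof (induction Js rule: rev_induct)
  case (snoc J Js)
  then show ?case using admissible_snoc(1)[of "Is @ Js" J] by simp
qed simp

lemma subdivision_run_nested_stage:
  "subdivision_run Is Q lab \<Longrightarrow> admissible Is \<Longrightarrow> nested_stage (blocks Is) Q lab"
proof (induction rule: subdivision_run.induct)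
  case (start lab)
  then show ?case
    using complex_iso_cross_polytope[of lab] simplicial_cross_polytope affine_hull_cross_polytope
    by (simp add: nested_stage_def blocks_def)
next
  case (step Is Q lab I v)
  note a = admissible_snoc[OF step.prems]
  show ?case
    unfolding blocks_snoc
    using nested_stage_stellar_subdivision[OF a(2) step.IH[OF a(1)] step.hyps(3)] .
qed

lemma subdivision_run_exists:
  fixes Is :: "'n::finite set list"
  shows "admissible Is \<Longrightarrow> \<exists>P lab. subdivision_run Is P lab"
proof (induction Is rule: rev_induct)
  case Nil
  \<comment> \<open>\<open>the_elem\<close> reads \<open>i\<close> off \<open>{i}\<close>; at other
    blocks the value is a placeholder.\<close>
  have "subdivision_run [] cross_polytope
      (\<lambda>l :: 'n label. case l of Block J \<Rightarrow> axis (the_elem J) 1 | Formal i \<Rightarrow> - axis i 1)"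
    by (rule subdivision_run.start) auto
  then show ?case by blast
next
  case (snoc I Is)
  note a = admissible_snoc[OF snoc.prems]
  obtain Q lab where r: "subdivision_run Is Q lab" using snoc.IH a(1) by blast
  note st = subdivision_run_nested_stage[OF r a(1)]
  show ?case
    using nested_stage_stellar_point_exists[OF a(2) st] singleton_vertices_face[OF a(2) st]
      subdivision_run.step[OF r] by blast
qed

theorem theorem3p3:
  fixes B :: "'n::finite set set" and Is :: "'n set list"
  assumes "building_set UNIV B"
    and "distinct Is"
    and "set Is = {I \<in> B. \<not> is_singleton I}"
    and "sorted_wrt (\<lambda>I J. card I \<ge> card J) Is"
  shows "(\<forall>k < length Is. \<forall>Q lab. subdivision_run (take k Is) Q lab \<longrightarrow>
            simplicial_polytope Q \<and>
            singleton_vertices lab (Is ! k) \<in> snd (boundary_complex Q) \<and>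
            (\<exists>v. stellar_point Q (convex hull (singleton_vertices lab (Is ! k))) v)) \<and>
         (\<exists>P lab. subdivision_run Is P lab) \<and>
         (\<forall>P lab. subdivision_run Is P lab \<longrightarrow>
            simplicial_polytope P \<and>
            complex_iso lab (extended_nested_complex UNIV B) (boundary_complex P)) \<and>
         (\<exists>(P :: (real ^ 'n) set) f. simplicial_polytope P \<and>
            complex_iso f (extended_nested_complex UNIV B) (boundary_complex P))"
proof -
  have B: "blocks Is = B"
    using assms(1,3) by (auto simp: blocks_def building_set_def is_singleton_def)
  have adm: "admissible Is"
    using assms B by (auto simp: admissible_def)
  have "simplicial_polytope Q \<and>
      singleton_vertices lab (Is ! k) \<in> snd (boundary_complex Q) \<and>
      (\<exists>v. stellar_point Q (convex hull (singleton_vertices lab (Is ! k))) v)"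
    if k: "k < length Is" and r: "subdivision_run (take k Is) Q lab" for k Q lab
  proof -
    \<comment> \<open>The segment includes the block \<open>Is ! k\<close>, so that splitting it off
      gives both the stage before it and the extension by it.\<close>
    have "admissible (take (Suc k) Is)"
      using adm admissible_appendD[of "take (Suc k) Is" "drop (Suc k) Is"] by simp
    then have "admissible (take k Is @ [Is ! k])"
      using k by (simp add: take_Suc_conv_app_nth)
    note a = admissible_snoc[OF this]
    note st = subdivision_run_nested_stage[OF r a(1)]
    show ?thesis
      using singleton_vertices_face[OF a(2) st] nested_stage_stellar_point_exists[OF a(2) st] st
      by (simp add: nested_stage_def)
  qed
  moreover have "simplicial_polytope P \<and>
      complex_iso lab (extended_nested_complex UNIV B) (boundary_complex P)"
    if "subdivision_run Is P lab" for P lab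
    using subdivision_run_nested_stage[OF that adm] by (simp add: nested_stage_def B)
  ultimately show ?thesis
    using subdivision_run_exists[OF adm] by blast
qed

end
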